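(* Let $\mathbb{F}\in\{\mathbb{R},\mathbb{C}\}$ and let $A\in\mathbb{F}_d[z,z^{-1}]$ satisfy $A^{\rm T}=-A$ and be invertible on the unit circle, with (symmetric) partial indices $\mathcal{K}=\{\kappa_1\ge\dots\ge\kappa_d\}$. Then there exists a factorization $A=A_+D_3A_+^{\rm T}$ with $A_+\in\mathbb{F}_d[z]$ invertible for all $|z|\le1$ and $$D_3=-\sum_{m\in\mathcal{M}_+}\big(z^{\kappa_m}|\bar m\rangle\langle m|-z^{-\kappa_m}|m\rangle\langle \bar m|\big)+\sum_{m\in\mathcal{M}_0,\ m\le d/2}\big(|\bar m\rangle\langle m|-|m\rangle\langle\bar m|\big).$$
   Context: $\mathbb{F}_d[z,z^{-1}]$ denotes matrix Laurent polynomials $\sum_{r=p}^qa_rz^r$ with $a_r\in\mathbb{F}_d$; $\mathbb{F}_d[z]$ those with only nonnegative powers. For $A(z)=\sum a_rz^r$, $A^{\rm T}(z):=\sum_r a_r^{\rm T}z^{-r}$. A standard WH factorization of $A$ invertible on $|z|=1$ is $A=A_+DA_-$ with $A_+$ a polynomial in $z$ invertible for $|z|\le1$, $A_-$ a polynomial in $z^{-1}$ invertible for $|z^{-1}|\le1$, $D=\mathrm{diag}(z^{\kappa_1},\dots,z^{\kappa_d})$, $\kappa_1\ge\dots\ge\kappa_d$; the $\kappa_m$ (partial indices) are unique and here form $\mathcal{K}$. $\mathcal{M}_\pm=\{m:\pm\kappa_m>0\}$, $\mathcal{M}_0=\{m:\kappa_m=0\}$, $\bar m:=d+1-m$, and $|m\rangle\langle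 m'|$ denotes the matrix unit at $(m,m')$. *)

theory Defs
  imports "HOL-Analysis.Analysis" "Jordan_Normal_Form.Determinant"
begin

text \<open>d x d matrix functions of a complex variable z. Matrices are Jordan_Normal_Form
  matrices with 0-based indices; the paper's 1-based index m corresponds to row/column m-1.
  A coefficient field F is a subset of the complex numbers (F = Reals or F = UNIV).\<close>

definition is_laurent_mat :: "nat \<Rightarrow> complex set \<Rightarrow> (complex \<Rightarrow> complex mat) \<Rightarrow> bool" where
  "is_laurent_mat d F A \<longleftrightarrow> (\<exists>(p::int) (q::int) (a::int \<Rightarrow> complex mat).
     (\<forall>r i j. i < d \<longrightarrow> j < d \<longrightarrow> a r $$ (i,j) \<in> F) \<and>
     (\<forall>z. z \<noteq> 0 \<longrightarrow> A z = mat d d (\<lambda>(i,j). \<Sum>r\<in>{p..q}. z powi r * a r $$ (i,j))))"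

definition is_poly_mat :: "nat \<Rightarrow> complex set \<Rightarrow> (complex \<Rightarrow> complex mat) \<Rightarrow> bool" where
  "is_poly_mat d F P \<longleftrightarrow> (\<exists>(q::nat) (a::nat \<Rightarrow> complex mat).
     (\<forall>r i j. i < d \<longrightarrow> j < d \<longrightarrow> a r $$ (i,j) \<in> F) \<and>
     (\<forall>z. P z = mat d d (\<lambda>(i,j). \<Sum>r\<le>q. z ^ r * a r $$ (i,j))))"

text \<open>The "transpose" A^T(z) = sum a_r^T z^{-r} = (A(1/z))^T.\<close>
definition lt_transpose :: "(complex \<Rightarrow> complex mat) \<Rightarrow> complex \<Rightarrow> complex mat" where
  "lt_transpose A z = transpose_mat (A (1 / z))"

definition diag_pow :: "nat \<Rightarrow> (nat \<Rightarrow> int) \<Rightarrow> complex \<Rightarrow> complex mat" where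
  "diag_pow d \<kappa> z = mat d d (\<lambda>(i,j). if i = j then z powi \<kappa> (i+1) else 0)"

text \<open>Standard Wiener-Hopf factorization A = A_+ D A_- with partial indices kappa
  (kappa_1 \<ge> ... \<ge> kappa_d). A_- is a polynomial in z^{-1}: A_-(z) = P(1/z) with P a
  polynomial invertible on |w| \<le> 1.\<close>
definition has_partial_indices :: "nat \<Rightarrow> complex set \<Rightarrow> (complex \<Rightarrow> complex mat) \<Rightarrow> (nat \<Rightarrow> int) \<Rightarrow> bool" where
  "has_partial_indices d F A \<kappa> \<longleftrightarrow>
     (\<forall>m m'. 1 \<le> m \<longrightarrow> m \<le> m' \<longrightarrow> m' \<le> d \<longrightarrow> \<kappa> m' \<le> \<kappa> m) \<and>
     (\<exists>Ap Pm. is_poly_mat d F Ap \<and> (\<forall>z. cmod z \<le> 1 \<longrightarrow> det (Ap z) \<noteq> 0) \<and>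
        is_poly_mat d F Pm \<and> (\<forall>w. cmod w \<le> 1 \<longrightarrow> det (Pm w) \<noteq> 0) \<and>
        (\<forall>z. z \<noteq> 0 \<longrightarrow> A z = Ap z * diag_pow d \<kappa> z * Pm (1 / z)))"

definition munit :: "nat \<Rightarrow> nat \<Rightarrow> nat \<Rightarrow> complex mat" where
  "munit d a b = mat d d (\<lambda>(i,j). if i + 1 = a \<and> j + 1 = b then 1 else 0)"

definition D3 :: "nat \<Rightarrow> (nat \<Rightarrow> int) \<Rightarrow> complex \<Rightarrow> complex mat" where
  "D3 d \<kappa> z = mat d d (\<lambda>(i,j).
     - (\<Sum>m\<in>{m. 1 \<le> m \<and> m \<le> d \<and> \<kappa> m > 0}.
          z powi \<kappa> m * munit d (d+1-m) m $$ (i,j) - z powi (- \<kappa> m) * munit d m (d+1-m) $$ (i,j))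
     + (\<Sum>m\<in>{m. 1 \<le> m \<and> m \<le> d \<and> \<kappa> m = 0 \<and> 2 * m \<le> d}.
          munit d (d+1-m) m $$ (i,j) - munit d m (d+1-m) $$ (i,j)))"

end

theory Submission
  imports Defs "HOL-Computational_Algebra.Field_as_Ring"
    "HOL-Computational_Algebra.Fundamental_Theorem_Algebra"
begin

text \<open>Let \<open>A = P D Q(1/z)\<close> be the given factorization and put \<open>H = Q P\<^sup>-\<^sup>T\<close>, so that
  \<open>A = P B P\<^sup>T\<close> with \<open>B = D H(1/z)\<close>. Skewness of \<open>A\<close> reads
  \<open>H\<^sub>j\<^sub>i(z) = - z^(k\<^sub>i + k\<^sub>j) H\<^sub>i\<^sub>j(1/z)\<close>. Since \<open>H\<close> has no poles in the closed disc, both sides are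
  polynomials; they vanish if \<open>k\<^sub>i + k\<^sub>j < 0\<close> and are constant if \<open>k\<^sub>i + k\<^sub>j = 0\<close>. The determinant of
  \<open>H\<close> has no zeros at all, so it is constant and the indices sum to \<open>0\<close>; in its Leibniz expansion only
  permutations pairing \<open>k\<close> with \<open>-k\<close> survive. This gives the symmetry of the indices and the
  invertibility of the constant matrix \<open>h\<close> formed by the blocks \<open>k\<^sub>i + k\<^sub>j = 0\<close>. A unipotent polynomial
  congruence turns \<open>B\<close> into \<open>D h\<close>, and a symplectic Gram--Schmidt process respecting the grading by
  \<open>k\<close> brings \<open>h\<close> to antidiagonal form, which is \<open>D\<^sub>3\<close> up to scaling.\<close>

section \<open>Polynomials and their reflections\<close>

lemma poly_eqI_nonzero:
  fixes a b :: "complex poly"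
  assumes "\<And>z. z \<noteq> 0 \<Longrightarrow> poly a z = poly b z"
  shows "a = b"
proof (rule ccontr)
  assume "a \<noteq> b"
  hence "finite {z. poly (a - b) z = 0}" by (intro poly_roots_finite) simp
  moreover have "- {0} \<subseteq> {z. poly (a - b) z = 0}" using assms by auto
  ultimately have "finite (- {0::complex})" by (rule rev_finite_subset)
  thus False by (simp add: infinite_UNIV_char_0 finite_compl)
qed

text \<open>Over the complex numbers a gcd that is not a unit has a root, and that root is common to
  both.\<close>

lemma coprime_poly_complexI:
  fixes a b :: "complex poly"
  assumes "\<And>z. poly a z = 0 \<Longrightarrow> poly b z = 0 \<Longrightarrow> False"
  shows "coprime a b"
proof (rule ccontr)
  assume nc: "\<not> coprime a b"
  have "\<exists>z. poly (gcd a b) z = 0"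
  proof (rule ccontr)
    assume "\<not> (\<exists>z. poly (gcd a b) z = 0)"
    with fundamental_theorem_of_algebra_alt[of "gcd a b"]
    obtain c where "c \<noteq> 0" "gcd a b = [:c:]" by auto
    hence "is_unit (gcd a b)" by (simp add: is_unit_const_poly_iff dvd_field_iff)
    with nc show False by (simp only: is_unit_gcd_iff coprime_iff_gcd_eq_1 simp_thms)
  qed
  then obtain z where z: "poly (gcd a b) z = 0" by blast
  have "poly a z = 0" "poly b z = 0"
    using z by (metis dvdE gcd_dvd1 mult_zero_left poly_mult)
       (use z in \<open>metis dvdE gcd_dvd2 mult_zero_left poly_mult\<close>)
  thus False by (rule assms)
qed

text \<open>Clears the negative powers, so that an identity between Laurent polynomials can be read
  in the polynomial ring, where divisibility and cancellation are available.\<close>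

lemma powi_reflect_poly:
  fixes M :: "complex poly" and k :: int
  obtains e l where "\<And>z. z \<noteq> 0 \<Longrightarrow> z ^ e * (z powi k * poly M (1 / z)) = poly (monom 1 l * reflect_poly M) z"
proof
  fix z :: complex assume z: "z \<noteq> 0"
  define e where "e = nat \<bar>k\<bar> + degree M"
  \<comment> \<open>With this \<open>e\<close> the sum \<open>e + k\<close> is at least the degree
    of \<open>M\<close>, so \<open>nat\<close> truncates nothing.\<close>
  define l where "l = nat (int e + k - int (degree M))"
  have l: "int e + k = int (l + degree M)" unfolding l_def e_def by auto
  have "z ^ e * z powi k = z powi (int e + k)" using z by (simp add: power_int_add)
  also have "\<dots> = z ^ l * z ^ degree M" unfolding l power_int_of_nat by (rule power_add)
  finally have "z ^ e * (z powi k * poly M (1 / z)) = z ^ l * (z ^ degree M * poly M (1 / z))"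
    by (metis mult.assoc)
  thus "z ^ (nat \<bar>k\<bar> + degree M) * (z powi k * poly M (1 / z))
      = poly (monom 1 (nat (int (nat \<bar>k\<bar> + degree M) + k - int (degree M))) * reflect_poly M) z"
    using z by (simp add: e_def l_def poly_monom poly_reflect_poly_nz inverse_eq_divide)
qed

text \<open>The roots of \<open>p\<close> lie outside the closed unit disc and those of its reflection inside the open
  one, so the two are coprime.\<close>

lemma dvd_of_reflection:
  fixes p N M :: "complex poly" and k :: int
  assumes p: "\<And>z. cmod z \<le> 1 \<Longrightarrow> poly p z \<noteq> 0"
    and eq: "\<And>z. z \<noteq> 0 \<Longrightarrow>
      poly N z * poly p (1 / z) = - (z powi k) * poly p z * poly M (1 / z)"
  shows "p dvd N"
proof -
  obtain e l where el: "\<And>z. z \<noteq> 0 \<Longrightarrow> z ^ e * (z powi k * poly M (1 / z)) = poly (monom 1 l * reflect_poly M) z"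
    by (rule powi_reflect_poly[of k M]) blast
  \<comment> \<open>The hypothesis multiplied by \<open>z ^ (e + degree p)\<close>.\<close>
  have "monom 1 e * reflect_poly p * N = - (p * monom 1 (degree p) * (monom 1 l * reflect_poly M))"
  proof (rule poly_eqI_nonzero)
    fix z :: complex assume z: "z \<noteq> 0"
    have "poly (monom 1 e * reflect_poly p * N) z = z ^ e * z ^ degree p * (poly N z * poly p (1 / z))"
      using z by (simp add: poly_monom poly_reflect_poly_nz inverse_eq_divide)
    also have "\<dots> = - (poly p z * z ^ degree p * (z ^ e * (z powi k * poly M (1 / z))))"
      unfolding eq[OF z] by (simp add: mult_ac)
    also have "\<dots> = poly (- (p * monom 1 (degree p) * (monom 1 l * reflect_poly M))) z"
      unfolding el[OF z] by (simp add: poly_monom)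
    finally show "poly (monom 1 e * reflect_poly p * N) z
        = poly (- (p * monom 1 (degree p) * (monom 1 l * reflect_poly M))) z" .
  qed
  hence "p dvd monom 1 e * reflect_poly p * N" by (simp add: mult.assoc)
  moreover have "coprime p (monom 1 e * reflect_poly p)"
  proof (rule coprime_poly_complexI)
    fix z assume r: "poly p z = 0" "poly (monom 1 e * reflect_poly p) z = 0"
    with p have z: "cmod z > 1" by force
    hence "z \<noteq> 0" by auto
    with r have "poly p (1 / z) = 0"
      by (simp add: poly_monom poly_reflect_poly_nz inverse_eq_divide)
    moreover have "cmod (1 / z) \<le> 1" using z by (simp add: norm_divide divide_le_eq_1)
    ultimately show False using p by blast
  qed
  ultimately show ?thesis by (simp add: coprime_dvd_mult_right_iff)
qed

text \<open>As a Laurent polynomial the right-hand side of \<open>eq\<close> has no exponent above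
  \<open>k\<close>, while \<open>h\<close> has none below 0.\<close>

lemma reflection_degree:
  fixes h m :: "complex poly" and k :: int
  assumes eq: "\<And>z. z \<noteq> 0 \<Longrightarrow> poly h z = - (z powi k) * poly m (1 / z)" and "k \<le> 0"
  shows "h = [:if k = 0 then coeff h 0 else 0:]"
proof (cases "h = 0")
  case False
  have "monom 1 (nat (- k) + degree m) * h = - reflect_poly m"
  proof (rule poly_eqI_nonzero)
    fix z :: complex assume z: "z \<noteq> 0"
    have "z ^ nat (- k) * z powi k = 1"
      using z \<open>k \<le> 0\<close> by (auto simp: power_int_def simp flip: power_mult_distrib)
    hence "z ^ nat (- k) * (z powi k * c) = c" for c by (metis mult.assoc mult_1)
    thus "poly (monom 1 (nat (- k) + degree m) * h) z = poly (- reflect_poly m) z"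
      using z by (simp add: poly_monom poly_reflect_poly_nz inverse_eq_divide eq power_add mult_ac)
  qed
  hence "degree (monom 1 (nat (- k) + degree m) * h) \<le> degree m"
    using degree_reflect_poly_le[of m] by simp
  hence "nat (- k) + degree m + degree h \<le> degree m"
    using False by (subst (asm) degree_mult_eq) (auto simp: degree_monom_eq)
  hence "k = 0" "degree h = 0" using \<open>k \<le> 0\<close> by auto
  thus ?thesis by (auto elim!: degree_eq_zeroE)
qed auto

text \<open>The common factor may vanish at the point in question, so it is cancelled in the
  polynomial ring after clearing denominators.\<close>

lemma reflection_cancel:
  fixes p h m :: "complex poly" and k :: int
  assumes "p \<noteq> 0" and eq: "\<And>z. z \<noteq> 0 \<Longrightarrow>
      poly p z * poly p (1 / z) * poly h z = poly p z * poly p (1 / z) * (- (z powi k) * poly m (1 / z))"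
    and z: "z \<noteq> 0"
  shows "poly h z = - (z powi k) * poly m (1 / z)"
proof -
  obtain e l where el: "\<And>z. z \<noteq> 0 \<Longrightarrow> z ^ e * (z powi k * poly m (1 / z)) = poly (monom 1 l * reflect_poly m) z"
    by (rule powi_reflect_poly[of k m]) blast
  have "p * reflect_poly p * (monom 1 e * h + monom 1 l * reflect_poly m) = 0"
  proof (rule poly_eqI_nonzero)
    fix z :: complex assume z: "z \<noteq> 0"
    have "poly (p * reflect_poly p * (monom 1 e * h + monom 1 l * reflect_poly m)) z
        = poly p z * (z ^ degree p * poly p (1 / z)) * (z ^ e * poly h z + z ^ e * (z powi k * poly m (1 / z)))"
      using z by (simp add: el poly_monom poly_reflect_poly_nz inverse_eq_divide)
    also have "\<dots> = z ^ degree p * z ^ e * (poly p z * poly p (1 / z) * poly h z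
        - poly p z * poly p (1 / z) * (- (z powi k) * poly m (1 / z)))"
      by (simp add: algebra_simps)
    finally show "poly (p * reflect_poly p * (monom 1 e * h + monom 1 l * reflect_poly m)) z = poly 0 z"
      unfolding eq[OF z] by simp
  qed
  hence "monom 1 e * h + monom 1 l * reflect_poly m = 0" using assms(1) by simp
  hence "poly (monom 1 e * h + monom 1 l * reflect_poly m) z = 0" by simp
  hence "z ^ e * (poly h z + z powi k * poly m (1 / z)) = 0"
    using el[OF z] by (simp add: poly_monom distrib_left)
  thus ?thesis using z by (simp add: eq_neg_iff_add_eq_0)
qed

section \<open>Polynomial functions with real or complex coefficients\<close>

locale coefficient_field =
  fixes F :: "complex set"
  assumes F: "F = \<real> \<or> F = UNIV"
begin

lemma closed:
  "0 \<in> F" "1 \<in> F" "x \<in> F \<Longrightarrow> y \<in> F \<Longrightarrow> x + y \<in> F" "x \<in> F \<Longrightarrow> y \<in> F \<Longrightarrow> x * y \<in> F"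
  "x \<in> F \<Longrightarrow> - x \<in> F" "x \<in> F \<Longrightarrow> y \<in> F \<Longrightarrow> x / y \<in> F"
  using F by auto

lemma sum_closed: "(\<And>i. i \<in> I \<Longrightarrow> f i \<in> F) \<Longrightarrow> sum f I \<in> F"
  using F by (auto intro: sum_in_Reals)

text \<open>Evaluation functions rather than formal polynomials, because the matrices of the theorem
  are functions of \<open>z\<close> and determinants and adjugates are formed pointwise.\<close>

definition polys :: "(complex \<Rightarrow> complex) set" where
  "polys = {f. \<exists>p. (\<forall>i. coeff p i \<in> F) \<and> f = poly p}"

lemma polysI: "(\<And>i. coeff p i \<in> F) \<Longrightarrow> poly p \<in> polys"
  unfolding polys_def by auto

lemma polysE:
  assumes "f \<in> polys"
  obtains p where "\<And>i. coeff p i \<in> F" "f = poly p"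
  using assms unfolding polys_def by auto

lemma polys_at_0: "f \<in> polys \<Longrightarrow> f 0 \<in> F"
  by (auto simp: polys_def poly_0_coeff_0)

lemma polys_const: "c \<in> F \<Longrightarrow> (\<lambda>_. c) \<in> polys"
  unfolding polys_def using closed
  by (auto intro!: exI[of _ "[:c:]"] simp: coeff_pCons split: nat.splits)

lemma polys_add:
  assumes "f \<in> polys" "g \<in> polys" shows "(\<lambda>z. f z + g z) \<in> polys"
proof -
  obtain p q where "\<And>i. coeff p i \<in> F" "f = poly p" "\<And>i. coeff q i \<in> F" "g = poly q"
    using assms by (auto elim!: polysE)
  thus ?thesis unfolding polys_def using closed by (auto intro!: exI[of _ "p + q"])
qed

lemma polys_mult:
  assumes "f \<in> polys" "g \<in> polys" shows "(\<lambda>z. f z * g z) \<in> polys"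
proof -
  obtain p q where "\<And>i. coeff p i \<in> F" "f = poly p" "\<And>i. coeff q i \<in> F" "g = poly q"
    using assms by (auto elim!: polysE)
  thus ?thesis unfolding polys_def using closed
    by (auto intro!: exI[of _ "p * q"] sum_closed simp: coeff_mult)
qed

lemma polys_sum: "(\<And>i. i \<in> I \<Longrightarrow> f i \<in> polys) \<Longrightarrow> (\<lambda>z. \<Sum>i\<in>I. f i z) \<in> polys"
  by (induction I rule: infinite_finite_induct) (auto intro: polys_add polys_const closed)

lemma polys_prod: "(\<And>i. i \<in> I \<Longrightarrow> f i \<in> polys) \<Longrightarrow> (\<lambda>z. \<Prod>i\<in>I. f i z) \<in> polys"
  by (induction I rule: infinite_finite_induct) (auto intro: polys_mult polys_const closed)

text \<open>Only the real case has content: coefficientwise conjugation fixes \<open>p\<close> and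
  \<open>p * h\<close>, hence, after cancelling \<open>p\<close>, also \<open>h\<close>.\<close>

lemma polys_quotient:
  assumes p: "\<And>i. coeff p i \<in> F" "p \<noteq> 0" and ph: "\<And>i. coeff (p * h) i \<in> F"
  shows "poly h \<in> polys"
proof (cases "F = UNIV")
  case False
  hence R: "F = \<real>" using F by simp
  have real: "map_poly cnj q = q" if "\<And>i. coeff q i \<in> F" for q
    using that R by (intro poly_eqI) (simp add: coeff_map_poly Reals_cnj_iff)
  have "p * map_poly cnj h = p * h"
  proof (rule poly_eqI_nonzero)
    fix z :: complex
    have *: "poly (map_poly cnj q) z = cnj (poly q (cnj z))" for q
      by (metis complex_cnj_cnj poly_cnj)
    have "poly (p * map_poly cnj h) z = poly (map_poly cnj (p * h)) z"
      by (subst real[OF p(1), symmetric]) (simp add: *)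
    also have "\<dots> = poly (p * h) z" by (subst real[OF ph]) simp
    finally show "poly (p * map_poly cnj h) z = poly (p * h) z" .
  qed
  hence "map_poly cnj h = h" using p by simp
  hence "cnj (coeff h i) = coeff h i" for i by (metis coeff_map_poly complex_cnj_zero)
  thus ?thesis using R by (intro polysI) (simp add: Reals_cnj_iff)
qed (rule polysI, simp)

section \<open>Matrices of polynomial functions\<close>

definition poly_mats :: "nat \<Rightarrow> (complex \<Rightarrow> complex mat) set" where
  "poly_mats d = {P. (\<forall>z. P z \<in> carrier_mat d d) \<and> (\<forall>i<d. \<forall>j<d. (\<lambda>z. P z $$ (i,j)) \<in> polys)}"

lemma poly_matsI:
  "(\<And>z. P z \<in> carrier_mat d d) \<Longrightarrow> (\<And>i j. i < d \<Longrightarrow> j < d \<Longrightarrow> (\<lambda>z. P z $$ (i,j)) \<in> polys) \<Longrightarrow> P \<in> poly_mats d"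
  and poly_mats_carrier: "P \<in> poly_mats d \<Longrightarrow> P z \<in> carrier_mat d d"
  and poly_mats_entry: "P \<in> poly_mats d \<Longrightarrow> i < d \<Longrightarrow> j < d \<Longrightarrow> (\<lambda>z. P z $$ (i,j)) \<in> polys"
  by (auto simp: poly_mats_def)

lemma poly_mats_dim:
  assumes "P \<in> poly_mats d"
  shows "dim_row (P z) = d" "dim_col (P z) = d"
  using poly_mats_carrier[OF assms, of z] by auto

lemma is_poly_mat_iff: "is_poly_mat d F P \<longleftrightarrow> P \<in> poly_mats d"
proof
  assume "is_poly_mat d F P"
  then obtain q a where a: "\<And>r i j. i < d \<Longrightarrow> j < d \<Longrightarrow> a r $$ (i,j) \<in> F"
    and P: "\<And>z. P z = mat d d (\<lambda>(i,j). \<Sum>r\<le>(q::nat). z ^ r * a r $$ (i,j))"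
    unfolding is_poly_mat_def by blast
  show "P \<in> poly_mats d"
  proof (rule poly_matsI)
    fix i j assume ij: "i < d" "j < d"
    have eq: "(\<lambda>z. P z $$ (i,j)) = poly (\<Sum>r\<le>q. monom (a r $$ (i,j)) r)"
      using ij by (auto simp: P poly_sum poly_monom mult.commute)
    show "(\<lambda>z. P z $$ (i,j)) \<in> polys" unfolding eq
      by (rule polysI) (auto simp: coeff_sum ij intro!: sum_closed a closed)
  qed (simp add: P)
next
  assume P: "P \<in> poly_mats d"
  hence "\<forall>i<d. \<forall>j<d. \<exists>p. (\<forall>r. coeff p r \<in> F) \<and> (\<lambda>z. P z $$ (i,j)) = poly p"
    by (auto simp: poly_mats_def polys_def)
  then obtain p where p: "\<And>i j r. i < d \<Longrightarrow> j < d \<Longrightarrow> coeff (p i j) r \<in> F"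
    "\<And>i j. i < d \<Longrightarrow> j < d \<Longrightarrow> (\<lambda>z. P z $$ (i,j)) = poly (p i j)" by metis
  \<comment> \<open>One degree bound for all entries; inserting 0 covers the empty matrix.\<close>
  define q where "q = Max (insert 0 ((\<lambda>(i,j). degree (p i j)) ` ({..<d} \<times> {..<d})))"
  have q: "degree (p i j) \<le> q" if "i < d" "j < d" for i j
    unfolding q_def using that by (intro Max_ge) force+
  show "is_poly_mat d F P" unfolding is_poly_mat_def
  proof (intro exI conjI allI impI)
    show "mat d d (\<lambda>(i,j). coeff (p i j) r) $$ (i,j) \<in> F" if "i < d" "j < d" for r i j
      using that p by simp
    show "P z = mat d d (\<lambda>(i,j). \<Sum>r\<le>q. z ^ r * mat d d (\<lambda>(i,j). coeff (p i j) r) $$ (i,j))" for z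
    proof (rule eq_matI)
      fix i j assume "i < dim_row (mat d d (\<lambda>(i,j). \<Sum>r\<le>q. z ^ r * mat d d (\<lambda>(i,j). coeff (p i j) r) $$ (i,j)))"
        "j < dim_col (mat d d (\<lambda>(i,j). \<Sum>r\<le>q. z ^ r * mat d d (\<lambda>(i,j). coeff (p i j) r) $$ (i,j)))"
      hence ij: "i < d" "j < d" by auto
      have "P z $$ (i,j) = poly (p i j) z" using p(2)[OF ij] by metis
      also have "\<dots> = (\<Sum>r\<le>q. coeff (p i j) r * z ^ r)"
        unfolding poly_altdef using q[OF ij]
        by (intro sum.mono_neutral_left) (auto simp: coeff_eq_0)
      finally show "P z $$ (i,j) = mat d d (\<lambda>(i,j). \<Sum>r\<le>q. z ^ r * mat d d (\<lambda>(i,j). coeff (p i j) r) $$ (i,j)) $$ (i,j)"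
        using ij by (simp add: mult.commute)
    qed (use poly_mats_carrier[OF P, of z] in auto)
  qed
qed

lemma poly_mats_const:
  "M \<in> carrier_mat d d \<Longrightarrow> (\<And>i j. i < d \<Longrightarrow> j < d \<Longrightarrow> M $$ (i,j) \<in> F) \<Longrightarrow> (\<lambda>_. M) \<in> poly_mats d"
  by (intro poly_matsI polys_const) auto

lemma poly_mats_transpose: "P \<in> poly_mats d \<Longrightarrow> (\<lambda>z. transpose_mat (P z)) \<in> poly_mats d"
proof (rule poly_matsI)
  fix i j assume *: "P \<in> poly_mats d" "i < d" "j < d"
  have "(\<lambda>z. transpose_mat (P z) $$ (i,j)) = (\<lambda>z. P z $$ (j,i))"
    using * by (simp add: poly_mats_dim)
  thus "(\<lambda>z. transpose_mat (P z) $$ (i,j)) \<in> polys" using * by (simp add: poly_mats_entry)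
qed (simp add: poly_mats_carrier)

lemma poly_mats_mult:
  assumes "P \<in> poly_mats d" "Q \<in> poly_mats d" shows "(\<lambda>z. P z * Q z) \<in> poly_mats d"
proof (rule poly_matsI)
  fix i j assume ij: "i < d" "j < d"
  have "(\<lambda>z. (P z * Q z) $$ (i,j)) = (\<lambda>z. \<Sum>k = 0..<d. P z $$ (i,k) * Q z $$ (k,j))"
    using ij assms by (simp add: poly_mats_dim scalar_prod_def)
  thus "(\<lambda>z. (P z * Q z) $$ (i,j)) \<in> polys"
    using ij assms by (auto intro!: polys_sum polys_mult poly_mats_entry)
qed (rule mult_carrier_mat[OF poly_mats_carrier[OF assms(1)] poly_mats_carrier[OF assms(2)]])

lemma polys_det:
  assumes "P \<in> poly_mats d" shows "(\<lambda>z. det (P z)) \<in> polys"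
proof -
  have "(\<lambda>z. det (P z)) = (\<lambda>z. \<Sum>p\<in>{p. p permutes {0..<d}}. signof p * (\<Prod>i = 0..<d. P z $$ (i, p i)))"
    by (intro ext det_def' poly_mats_carrier[OF assms])
  moreover have "signof p \<in> F" for p :: "nat \<Rightarrow> nat"
    using closed by (simp add: sign_def)
  ultimately show ?thesis
    by (auto intro!: polys_sum polys_mult polys_const polys_prod poly_mats_entry[OF assms]
        dest: permutes_in_image)
qed

text \<open>The adjugate inverts a matrix up to its determinant without leaving the polynomials over
  \<open>F\<close>.\<close>

lemma poly_mats_adj:
  assumes "P \<in> poly_mats d" shows "(\<lambda>z. adj_mat (P z)) \<in> poly_mats d"
proof (rule poly_matsI)
  fix i j assume ij: "i < d" "j < d"
  have del: "(\<lambda>z. mat_delete (P z) j i) \<in> poly_mats (d - 1)"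
  proof (rule poly_matsI)
    fix a b assume ab: "a < d - 1" "b < d - 1"
    have "(\<lambda>z. mat_delete (P z) j i $$ (a,b))
        = (\<lambda>z. P z $$ (if a < j then a else Suc a, if b < i then b else Suc b))"
      using ab by (simp add: mat_delete_def poly_mats_dim[OF assms])
    thus "(\<lambda>z. mat_delete (P z) j i $$ (a,b)) \<in> polys"
      using ab by (auto intro!: poly_mats_entry[OF assms])
  qed (use poly_mats_carrier[OF assms] mat_delete_carrier in blast)
  have "(\<lambda>z. adj_mat (P z) $$ (i,j)) = (\<lambda>z. (-1) ^ (j + i) * det (mat_delete (P z) j i))"
    using ij by (simp add: adj_mat_def cofactor_def poly_mats_dim[OF assms])
  moreover have "(-1) ^ n \<in> F" for n using closed by (cases "even n") auto
  ultimately show "(\<lambda>z. adj_mat (P z) $$ (i,j)) \<in> polys"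
    using del by (auto intro!: polys_mult polys_const polys_det)
qed (use poly_mats_carrier[OF assms] adj_mat in blast)

end

section \<open>Graded skew forms\<close>

text \<open>\<open>r\<close> is \<open>g\<close> after adding \<open>\<alpha> i\<close> times row
  \<open>a\<close> and \<open>\<beta> i\<close> times row \<open>b\<close> to each row
  \<open>i\<close>; the middle matrix results from the same operation on columns. Since both
  coefficient vectors vanish at \<open>a\<close> and \<open>b\<close>, the operation is undone by
  changing signs, which gives \<open>E\<close>.\<close>

lemma transvection_congruence:
  fixes g :: "'a :: comm_ring_1 mat" and \<alpha> \<beta> :: "nat \<Rightarrow> 'a"
  assumes g: "g \<in> carrier_mat d d" and ab: "a < d" "b < d" "a \<noteq> b"
    and z: "\<alpha> a = 0" "\<alpha> b = 0" "\<beta> a = 0" "\<beta> b = 0"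
  defines "E \<equiv> mat d d (\<lambda>(i,j). (if i = j then 1 else 0) - (if j = a then \<alpha> i else 0) - (if j = b then \<beta> i else 0))"
    and "r \<equiv> \<lambda>i j. g $$ (i,j) + \<alpha> i * g $$ (a,j) + \<beta> i * g $$ (b,j)"
  shows "g = E * mat d d (\<lambda>(i,j). r i j + \<alpha> j * r i a + \<beta> j * r i b) * transpose_mat E"
proof -
  define M where "M = mat d d (\<lambda>(i,j). r i j + \<alpha> j * r i a + \<beta> j * r i b)"
  have E: "(\<Sum>l = 0..<d. E $$ (i,l) * f l) = f i - \<alpha> i * f a - \<beta> i * f b" if "i < d" for i f
  proof -
    have "(\<Sum>l = 0..<d. E $$ (i,l) * f l) = (\<Sum>l = 0..<d. (if i = l then f l else 0)
        - (if l = a then \<alpha> i * f l else 0) - (if l = b then \<beta> i * f l else 0))"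
      using that by (intro sum.cong) (auto simp: E_def algebra_simps)
    thus ?thesis using that ab by (simp add: sum_subtractf)
  qed
  have [simp]: "E \<in> carrier_mat d d" "M \<in> carrier_mat d d" by (auto simp: E_def M_def)
  hence [simp]: "dim_row E = d" "dim_col E = d" "dim_row M = d" "dim_col M = d"
    by (auto simp del: \<open>E \<in> _\<close> \<open>M \<in> _\<close>)
  have EM: "(E * M) $$ (i,j) = g $$ (i,j) + \<alpha> j * g $$ (i,a) + \<beta> j * g $$ (i,b)" if "i < d" "j < d" for i j
  proof -
    have "(E * M) $$ (i,j) = (\<Sum>l = 0..<d. E $$ (i,l) * M $$ (l,j))"
      using that by (simp add: scalar_prod_def)
    also have "\<dots> = M $$ (i,j) - \<alpha> i * M $$ (a,j) - \<beta> i * M $$ (b,j)" by (rule E[OF that(1)])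
    also have "\<dots> = g $$ (i,j) + \<alpha> j * g $$ (i,a) + \<beta> j * g $$ (i,b)"
      using that ab by (simp add: M_def r_def z algebra_simps)
    finally show ?thesis .
  qed
  have "E * M * transpose_mat E = g"
  proof (rule eq_matI)
    fix i j assume "i < dim_row g" "j < dim_col g"
    with g have ij: "i < d" "j < d" by auto
    have "(E * M * transpose_mat E) $$ (i,j) = (\<Sum>l = 0..<d. E $$ (j,l) * (E * M) $$ (i,l))"
      using ij by (subst index_mult_mat) (simp_all add: scalar_prod_def mult.commute del: index_mult_mat(1))
    also have "\<dots> = (E * M) $$ (i,j) - \<alpha> j * (E * M) $$ (i,a) - \<beta> j * (E * M) $$ (i,b)"
      by (rule E[OF ij(2)])
    also have "\<dots> = g $$ (i,j)"
      using ij ab by (simp add: EM z algebra_simps del: index_mult_mat(1))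
    finally show "(E * M * transpose_mat E) $$ (i,j) = g $$ (i,j)" .
  qed (use g in auto)
  thus ?thesis by (simp add: M_def)
qed

text \<open>Left and right factors are independent, so that the rule covers constant congruences as
  well as those with \<open>P z\<close> on the left and the transpose of \<open>P (1 / z)\<close> on
  the right.\<close>

lemma congruence_trans:
  fixes g :: "'a :: comm_ring_1 mat"
  assumes "L \<in> carrier_mat d d" "L' \<in> carrier_mat d d" "R \<in> carrier_mat d d" "R' \<in> carrier_mat d d"
    "g \<in> carrier_mat d d"
  shows "L * (L' * g * transpose_mat R') * transpose_mat R = (L * L') * g * transpose_mat (R * R')"
  unfolding transpose_mult[OF assms(3,4)]
  using assms by (simp add: assoc_mult_mat[of _ d d _ d _ d])

lemma det_nonzero_row:
  fixes M :: "'a :: comm_ring_1 mat"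
  assumes "M \<in> carrier_mat d d" "det M \<noteq> 0" "i < d"
  obtains j where "j < d" "M $$ (i,j) \<noteq> 0"
proof -
  have "det M = 0" if z: "\<And>j. j < d \<Longrightarrow> M $$ (i,j) = 0"
  proof -
    have "(\<Prod>l = 0..<d. M $$ (l, p l)) = 0" if "p permutes {0..<d}" for p
      using assms(3) z[of "p i"] permutes_in_image[OF that, of i] by (intro prod_zero) auto
    thus ?thesis unfolding det_def'[OF assms(1)] by (intro sum.neutral) auto
  qed
  thus ?thesis using assms that by blast
qed

section \<open>Graded matrices and graded congruence\<close>

context coefficient_field
begin

text \<open>Support on equal indices makes \<open>L\<close> commute with the diagonal matrix
  \<open>D\<close> of powers of \<open>z\<close>, so a graded congruence of \<open>g\<close> is also
  one of \<open>D g\<close>.\<close>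

definition graded :: "nat \<Rightarrow> (nat \<Rightarrow> int) \<Rightarrow> complex mat \<Rightarrow> bool" where
  "graded d k L \<longleftrightarrow> L \<in> carrier_mat d d \<and>
     (\<forall>i<d. \<forall>j<d. L $$ (i,j) \<in> F \<and> (L $$ (i,j) \<noteq> 0 \<longrightarrow> k i = k j))"

text \<open>Support on opposite indices makes \<open>D g\<close> skew for the transpose that also
  replaces \<open>z\<close> by \<open>1 / z\<close>.\<close>

definition graded_skew :: "nat \<Rightarrow> (nat \<Rightarrow> int) \<Rightarrow> complex mat \<Rightarrow> bool" where
  "graded_skew d k g \<longleftrightarrow> g \<in> carrier_mat d d \<and> det g \<noteq> 0 \<and>
     (\<forall>i<d. \<forall>j<d. g $$ (i,j) \<in> F \<and> g $$ (j,i) = - g $$ (i,j) \<and> (g $$ (i,j) \<noteq> 0 \<longrightarrow> k i + k j = 0))"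

lemma graded_skew_carrier: "graded_skew d k g \<Longrightarrow> g \<in> carrier_mat d d"
  and graded_skew_det: "graded_skew d k g \<Longrightarrow> det g \<noteq> 0"
  unfolding graded_skew_def by blast+

lemma graded_skew_entry:
  assumes "graded_skew d k g" "i < d" "j < d"
  shows "g $$ (i,j) \<in> F" "g $$ (j,i) = - g $$ (i,j)" "g $$ (i,j) \<noteq> 0 \<Longrightarrow> k i + k j = 0"
  using assms unfolding graded_skew_def by blast+

lemma graded_skew_diag: "graded_skew d k g \<Longrightarrow> i < d \<Longrightarrow> g $$ (i,i) = 0"
  using graded_skew_entry(2)[of d k g i i] by simp

lemma graded_mult:
  assumes "graded d k L" "graded d k L'" shows "graded d k (L * L')"
proof -
  have "(L * L') $$ (i,j) \<in> F \<and> ((L * L') $$ (i,j) \<noteq> 0 \<longrightarrow> k i = k j)" if "i < d" "j < d" for i j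
  proof -
    have eq: "(L * L') $$ (i,j) = (\<Sum>l = 0..<d. L $$ (i,l) * L' $$ (l,j))"
      using assms that by (auto simp: graded_def scalar_prod_def)
    have "\<exists>l\<in>{0..<d}. L $$ (i,l) * L' $$ (l,j) \<noteq> 0" if "(L * L') $$ (i,j) \<noteq> 0"
      using that unfolding eq by (rule sum.not_neutral_contains_not_neutral) blast
    moreover have "(L * L') $$ (i,j) \<in> F"
      unfolding eq using assms that by (auto intro!: sum_closed closed simp: graded_def)
    ultimately show ?thesis using assms that by (force simp: graded_def)
  qed
  thus ?thesis using assms by (auto simp: graded_def simp del: index_mult_mat(1))
qed

definition graded_congruent :: "nat \<Rightarrow> (nat \<Rightarrow> int) \<Rightarrow> complex mat \<Rightarrow> complex mat \<Rightarrow> bool" where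
  "graded_congruent d k h g \<longleftrightarrow> (\<exists>L. graded d k L \<and> h = L * g * transpose_mat L)"

lemma graded_congruent_refl: "h \<in> carrier_mat d d \<Longrightarrow> graded_congruent d k h h"
  unfolding graded_congruent_def
  by (rule exI[of _ "1\<^sub>m d"]) (auto simp: graded_def closed)

lemma graded_congruent_trans:
  assumes "graded_congruent d k h g" "graded_congruent d k g g'" "g' \<in> carrier_mat d d"
  shows "graded_congruent d k h g'"
proof -
  obtain L L' where L: "graded d k L" "h = L * g * transpose_mat L"
    and L': "graded d k L'" "g = L' * g' * transpose_mat L'"
    using assms unfolding graded_congruent_def by blast
  have "h = (L * L') * g' * transpose_mat (L * L')"
    unfolding L(2) L'(2)
    by (intro congruence_trans[where d = d] assms(3)) (use L(1) L'(1) in \<open>simp_all add: graded_def\<close>)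
  with graded_mult[OF L(1) L'(1)] show ?thesis unfolding graded_congruent_def by blast
qed

text \<open>The conditions on \<open>\<alpha>\<close> and \<open>\<beta>\<close> mean that rows are
  added only to rows of equal index, so \<open>E\<close> is graded and the support of
  \<open>g\<close> is respected. Nondegeneracy follows from
  \<open>det g = det E * det M * det E\<close>.\<close>

lemma graded_transvection:
  assumes g: "graded_skew d k g" and ab: "a < d" "b < d" "a \<noteq> b"
    and z: "\<alpha> a = 0" "\<alpha> b = 0" "\<beta> a = 0" "\<beta> b = 0"
    and \<alpha>: "\<And>i. i < d \<Longrightarrow> \<alpha> i \<in> F" "\<And>i. i < d \<Longrightarrow> \<alpha> i \<noteq> 0 \<Longrightarrow> k i = k a"
    and \<beta>: "\<And>i. i < d \<Longrightarrow> \<beta> i \<in> F" "\<And>i. i < d \<Longrightarrow> \<beta> i \<noteq> 0 \<Longrightarrow> k i = k b"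
  defines "r \<equiv> \<lambda>i j. g $$ (i,j) + \<alpha> i * g $$ (a,j) + \<beta> i * g $$ (b,j)"
  defines "M \<equiv> mat d d (\<lambda>(i,j). r i j + \<alpha> j * r i a + \<beta> j * r i b)"
  shows "graded_skew d k M" "graded_congruent d k g M"
proof -
  define E where "E = mat d d (\<lambda>(i,j). (if i = j then 1 else 0) - (if j = a then \<alpha> i else 0) - (if j = b then \<beta> i else 0))"
  have gc: "g \<in> carrier_mat d d" and det: "det g \<noteq> 0" using g by (auto dest: graded_skew_carrier graded_skew_det)
  have eq: "g = E * M * transpose_mat E"
    unfolding E_def M_def r_def by (rule transvection_congruence[OF gc ab z])
  have [simp]: "E \<in> carrier_mat d d" "M \<in> carrier_mat d d" by (auto simp: E_def M_def)
  have diff: "x - y \<in> F" if "x \<in> F" "y \<in> F" for x y using F that by auto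
  have "graded d k E"
    unfolding graded_def using ab \<alpha> \<beta> closed diff by (auto simp: E_def)
  with eq show "graded_congruent d k g M" unfolding graded_congruent_def by blast
  have "det g = det E * det M * det E"
  proof -
    have "E * M \<in> carrier_mat d d" by (rule mult_carrier_mat[of _ d d]) simp_all
    thus ?thesis by (subst eq) (simp add: det_mult[where n = d] det_transpose[where n = d])
  qed
  hence "det M \<noteq> 0" using det by auto
  note e = graded_skew_entry[OF g]
  have rF: "r i j \<in> F" if "i < d" "j < d" for i j
    unfolding r_def using that e(1) ab \<alpha> \<beta> closed by simp
  have r0: "k i + k j = 0" if "i < d" "j < d" "r i j \<noteq> 0" for i j
    using that e(3) ab \<alpha>(2) \<beta>(2) unfolding r_def
    by (metis add_0 mult_zero_left mult_zero_right)
  have 1: "M $$ (i,j) \<in> F" if "i < d" "j < d" for i j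
    using that ab \<alpha> \<beta> closed rF by (simp add: M_def)
  have 2: "k i + k j = 0" if "i < d" "j < d" "M $$ (i,j) \<noteq> 0" for i j
  proof -
    have "r i j \<noteq> 0 \<or> \<alpha> j * r i a \<noteq> 0 \<or> \<beta> j * r i b \<noteq> 0" using that by (auto simp: M_def)
    thus ?thesis using that r0 ab \<alpha>(2) \<beta>(2) by force
  qed
  have 3: "M $$ (j,i) = - M $$ (i,j)" if ij: "i < d" "j < d" for i j
  proof -
    have s: "g $$ (j,i) = - g $$ (i,j)" "g $$ (a,i) = - g $$ (i,a)" "g $$ (b,i) = - g $$ (i,b)"
      "g $$ (a,j) = - g $$ (j,a)" "g $$ (b,j) = - g $$ (j,b)" "g $$ (a,b) = - g $$ (b,a)"
      "g $$ (a,a) = 0" "g $$ (b,b) = 0"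
      using ij ab e(2) graded_skew_diag[OF g] by blast+
    show ?thesis using ij by (simp add: M_def r_def s algebra_simps)
  qed
  show "graded_skew d k M"
    unfolding graded_skew_def using 1 2 3 \<open>det M \<noteq> 0\<close> \<open>M \<in> carrier_mat d d\<close> by blast
qed

text \<open>One step of the symplectic Gram--Schmidt process; the index pairs \<open>(i, d - 1 - i)\<close> with
  \<open>i < n\<close> have already been split off.\<close>

lemma antidiagonal_step:
  assumes g: "graded_skew d k g" and k: "\<And>i. i < d \<Longrightarrow> k (d - 1 - i) = - k i"
    and n: "2 * n + 1 < d"
    and split: "\<And>i j. i < d \<Longrightarrow> j < d \<Longrightarrow> i < n \<or> d - n \<le> i \<or> j < n \<or> d - n \<le> j \<Longrightarrow> i + j \<noteq> d - 1 \<Longrightarrow> g $$ (i,j) = 0"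
  obtains g' where "graded_skew d k g'" "graded_congruent d k g g'"
    "\<And>i j. i < d \<Longrightarrow> j < d \<Longrightarrow> i < Suc n \<or> d - Suc n \<le> i \<or> j < Suc n \<or> d - Suc n \<le> j \<Longrightarrow> i + j \<noteq> d - 1 \<Longrightarrow> g' $$ (i,j) = 0"
proof -
  define m where "m = d - 1 - n"
  have nm: "n < d" "m < d" "n \<noteq> m" "n < m" using n by (auto simp: m_def)
  have km: "k m = - k n" using k[of n] nm by (simp add: m_def)
  \<comment> \<open>First a nonzero pivot at \<open>(n,m)\<close> is arranged.\<close>
  obtain g1 where g1: "graded_skew d k g1" and c1: "graded_congruent d k g g1" and nz: "g1 $$ (n,m) \<noteq> 0"
    and split1: "\<And>i j. i < d \<Longrightarrow> j < d \<Longrightarrow> i < n \<or> d - n \<le> i \<or> j < n \<or> d - n \<le> j \<Longrightarrow> i + j \<noteq> d - 1 \<Longrightarrow> g1 $$ (i,j) = 0"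
  proof (cases "g $$ (n,m) = 0")
    case False
    have "graded_congruent d k g g" using g by (intro graded_congruent_refl graded_skew_carrier)
    thus ?thesis using that[OF g _ False split] by blast
  next
    case True
    \<comment> \<open>Nondegeneracy gives a nonzero entry in row \<open>n\<close>. Its column
      \<open>j\<close> has the same index as \<open>m\<close>, so adding row and column
      \<open>j\<close> to row and column \<open>m\<close> is graded and puts that entry at the pivot
      position.\<close>
    obtain j where j: "j < d" "g $$ (n,j) \<noteq> 0"
      using det_nonzero_row[OF graded_skew_carrier[OF g] graded_skew_det[OF g] nm(1)] .
    have jm: "j \<noteq> m" using j True by auto
    have jn: "j \<noteq> n" using j graded_skew_diag[OF g] nm by auto
    have j': "n \<le> j" "j < d - n"
      using split[of n j] j jm nm by (force simp: m_def)+
    have kj: "k j = k m" using graded_skew_entry(3)[OF g _ _ j(2)] j nm km by auto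
    define \<alpha> :: "nat \<Rightarrow> complex" where "\<alpha> i = (if i = m then 1 else 0)" for i
    \<comment> \<open>A single row operation suffices, hence \<open>\<beta> = 0\<close>, with
      \<open>n\<close> filling the second place.\<close>
    define \<beta> :: "nat \<Rightarrow> complex" where "\<beta> i = 0" for i
    define r where "r = (\<lambda>i l. g $$ (i,l) + \<alpha> i * g $$ (j,l) + \<beta> i * g $$ (n,l))"
    define M where "M = mat d d (\<lambda>(i,l). r i l + \<alpha> l * r i j + \<beta> l * r i n)"
    have *: "\<alpha> j = 0" "\<alpha> n = 0" "\<beta> j = 0" "\<beta> n = 0"
      "\<And>i. i < d \<Longrightarrow> \<alpha> i \<in> F" "\<And>i. i < d \<Longrightarrow> \<alpha> i \<noteq> 0 \<Longrightarrow> k i = k j"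
      "\<And>i. i < d \<Longrightarrow> \<beta> i \<in> F" "\<And>i. i < d \<Longrightarrow> \<beta> i \<noteq> 0 \<Longrightarrow> k i = k n"
      using jm nm kj by (auto simp: \<alpha>_def \<beta>_def closed split: if_splits)
    have T: "graded_skew d k M" "graded_congruent d k g M"
      unfolding M_def r_def by (rule graded_transvection[OF g j(1) nm(1) jn], (fact *)+)+
    show ?thesis
    proof (rule that[OF T])
      show "M $$ (n,m) \<noteq> 0"
        using nm j True by (simp add: M_def r_def \<alpha>_def \<beta>_def)
      fix i l assume il: "i < d" "l < d" "i < n \<or> d - n \<le> i \<or> l < n \<or> d - n \<le> l" "i + l \<noteq> d - 1"
      have "\<alpha> i * g $$ (j,l) = 0"
        using il j j' nm jm split[of j l] by (auto simp: \<alpha>_def m_def)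
      moreover have "\<alpha> l * g $$ (i,j) = 0"
        using il j j' nm jm split[of i j] by (auto simp: \<alpha>_def m_def)
      moreover have "\<alpha> i * \<alpha> l = 0" using il nm by (auto simp: \<alpha>_def m_def)
      moreover have "g $$ (i,l) = 0" using il by (intro split)
      ultimately show "M $$ (i,l) = 0"
        using il by (auto simp: M_def r_def \<beta>_def algebra_simps)
    qed
  qed
  note e = graded_skew_entry[OF g1] and diag = graded_skew_diag[OF g1]
  have mn: "g1 $$ (m,n) = - g1 $$ (n,m)" using nm by (intro e)
  \<comment> \<open>With pivots at \<open>(n,m)\<close> and \<open>(m,n)\<close> and a zero
    diagonal, \<open>\<alpha>\<close> clears column \<open>m\<close> and \<open>\<beta>\<close>
    clears column \<open>n\<close> without interfering.\<close>
  define \<alpha> where "\<alpha> i = (if i = n \<or> i = m then 0 else - g1 $$ (i,m) / g1 $$ (n,m))" for i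
  define \<beta> where "\<beta> i = (if i = n \<or> i = m then 0 else - g1 $$ (i,n) / g1 $$ (m,n))" for i
  define r where "r = (\<lambda>i l. g1 $$ (i,l) + \<alpha> i * g1 $$ (n,l) + \<beta> i * g1 $$ (m,l))"
  define M where "M = mat d d (\<lambda>(i,l). r i l + \<alpha> l * r i n + \<beta> l * r i m)"
  have z: "\<alpha> n = 0" "\<alpha> m = 0" "\<beta> n = 0" "\<beta> m = 0" by (auto simp: \<alpha>_def \<beta>_def)
  have \<alpha>: "\<alpha> i \<in> F" "\<alpha> i \<noteq> 0 \<Longrightarrow> k i = k n" if i: "i < d" for i
  proof -
    show "\<alpha> i \<in> F"
      unfolding \<alpha>_def by (simp add: closed(1)) (intro impI closed e(1) i nm)
    show "k i = k n" if "\<alpha> i \<noteq> 0"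
      using e(3)[OF i nm(2)] that km by (auto simp: \<alpha>_def split: if_splits)
  qed
  have \<beta>: "\<beta> i \<in> F" "\<beta> i \<noteq> 0 \<Longrightarrow> k i = k m" if i: "i < d" for i
  proof -
    show "\<beta> i \<in> F"
      unfolding \<beta>_def by (simp add: closed(1)) (intro impI closed e(1) i nm)
    show "k i = k m" if "\<beta> i \<noteq> 0"
      using e(3)[OF i nm(1)] that km by (auto simp: \<beta>_def split: if_splits)
  qed
  have T: "graded_skew d k M" "graded_congruent d k g1 M"
    unfolding M_def r_def by (rule graded_transvection[OF g1 nm(1,2,3)], (fact z \<alpha> \<beta>)+)+
  have rn: "r i n = 0" if "i < d" "i \<noteq> m" for i
    using that nz mn diag nm by (auto simp: r_def \<alpha>_def \<beta>_def)
  have rm: "r i m = 0" if "i < d" "i \<noteq> n" for i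
    using that nz mn diag nm by (auto simp: r_def \<alpha>_def \<beta>_def)
  have Mn: "M $$ (i,n) = 0" if "i < d" "i \<noteq> m" for i
    using that nm rn by (simp add: M_def z)
  have Mm: "M $$ (i,m) = 0" if "i < d" "i \<noteq> n" for i
    using that nm rm by (simp add: M_def z)
  \<comment> \<open>Rows \<open>n\<close> and \<open>m\<close> of \<open>g1\<close> vanish in the
    columns already split off, so nothing changes there.\<close>
  have Mold: "M $$ (i,l) = 0" if il: "i < d" "l < d" "l < n \<or> d - n \<le> l" "i + l \<noteq> d - 1" for i l
  proof -
    have l: "g1 $$ (n,l) = 0" "g1 $$ (m,l) = 0" "g1 $$ (i,l) = 0"
      using il nm by (auto intro!: split1 simp: m_def)
    have l': "g1 $$ (l,n) = 0" "g1 $$ (l,m) = 0"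
      using l e(2)[OF nm(1) il(2)] e(2)[OF nm(2) il(2)] by simp_all
    thus ?thesis using il l by (simp add: M_def r_def \<alpha>_def \<beta>_def)
  qed
  show ?thesis
  proof (rule that[OF T(1)])
    show "graded_congruent d k g M"
      using c1 T(2) graded_skew_carrier[OF T(1)] by (rule graded_congruent_trans)
    have *: "M $$ (i,l) = 0" if "i < d" "l < d" "l < Suc n \<or> d - Suc n \<le> l" "i + l \<noteq> d - 1" for i l
    proof -
      have "l < n \<or> d - n \<le> l \<or> l = n \<or> l = m" using that by (auto simp: m_def)
      thus ?thesis using that Mold Mn Mm nm by (auto simp: m_def)
    qed
    fix i l assume "i < d" "l < d" "i < Suc n \<or> d - Suc n \<le> i \<or> l < Suc n \<or> d - Suc n \<le> l" "i + l \<noteq> d - 1"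
    thus "M $$ (i,l) = 0"
      using *[of i l] *[of l i] graded_skew_entry(2)[OF T(1), of l i] by (auto simp: add.commute)
  qed
qed

lemma antidiagonal_form:
  assumes h: "graded_skew d k h" and k: "\<And>i. i < d \<Longrightarrow> k (d - 1 - i) = - k i"
  obtains g where "graded_skew d k g" "graded_congruent d k h g"
    "\<And>i j. i < d \<Longrightarrow> j < d \<Longrightarrow> i + j \<noteq> d - 1 \<Longrightarrow> g $$ (i,j) = 0"
proof -
  have "\<exists>g. graded_skew d k g \<and> graded_congruent d k h g \<and>
     (\<forall>i<d. \<forall>j<d. (i < n \<or> d - n \<le> i \<or> j < n \<or> d - n \<le> j) \<longrightarrow> i + j \<noteq> d - 1 \<longrightarrow> g $$ (i,j) = 0)"
    if "2 * n \<le> d" for n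
    using that
  proof (induction n)
    case 0
    have "graded_congruent d k h h" using h by (intro graded_congruent_refl graded_skew_carrier)
    thus ?case using h by (intro exI[of _ h]) auto
  next
    case (Suc n)
    then obtain g where g: "graded_skew d k g" "graded_congruent d k h g"
      and *: "\<And>i j. i < d \<Longrightarrow> j < d \<Longrightarrow> i < n \<or> d - n \<le> i \<or> j < n \<or> d - n \<le> j \<Longrightarrow> i + j \<noteq> d - 1 \<Longrightarrow> g $$ (i,j) = 0"
      by auto
    have "2 * n + 1 < d" using Suc.prems by simp
    from antidiagonal_step[OF g(1) k this *] obtain g' where
      g': "graded_skew d k g'" "graded_congruent d k g g'"
      "\<And>i j. i < d \<Longrightarrow> j < d \<Longrightarrow> i < Suc n \<or> d - Suc n \<le> i \<or> j < Suc n \<or> d - Suc n \<le> j \<Longrightarrow> i + j \<noteq> d - 1 \<Longrightarrow> g' $$ (i,j) = 0"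
      by blast
    moreover have "graded_congruent d k h g'"
      using g(2) g'(2) graded_skew_carrier[OF g'(1)] by (rule graded_congruent_trans)
    ultimately show ?case by blast
  qed
  \<comment> \<open>For odd \<open>d\<close> the middle index is not split off, but the only entry
    this leaves free lies on the antidiagonal.\<close>
  from this[of "d div 2"] obtain g where g: "graded_skew d k g" "graded_congruent d k h g"
    and *: "\<And>i j. i < d \<Longrightarrow> j < d \<Longrightarrow> (i < d div 2 \<or> d - d div 2 \<le> i \<or> j < d div 2 \<or> d - d div 2 \<le> j)
      \<Longrightarrow> i + j \<noteq> d - 1 \<Longrightarrow> g $$ (i,j) = 0" by auto
  show ?thesis
  proof (rule that[OF g])
    fix i j assume "i < d" "j < d" "i + j \<noteq> d - 1"
    moreover from this have "i < d div 2 \<or> d - d div 2 \<le> i \<or> j < d div 2 \<or> d - d div 2 \<le> j"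
      by linarith
    ultimately show "g $$ (i,j) = 0" by (intro *)
  qed
qed

end

section \<open>Factoring out the plus factor\<close>

text \<open>\<open>diag_pow\<close> with the exponents counted from 0.\<close>

definition dpow :: "nat \<Rightarrow> (nat \<Rightarrow> int) \<Rightarrow> complex \<Rightarrow> complex mat" where
  "dpow d k z = mat d d (\<lambda>(i,j). if i = j then z powi k i else 0)"

lemma dpow_carrier [simp]: "dpow d k z \<in> carrier_mat d d"
  by (simp add: dpow_def)

lemma dpow_dim [simp]: "dim_row (dpow d k z) = d" "dim_col (dpow d k z) = d"
  by (simp_all add: dpow_def)

lemma dpow_mult_entry:
  assumes "M \<in> carrier_mat d d" "i < d" "j < d"
  shows "(dpow d k z * M) $$ (i,j) = z powi k i * M $$ (i,j)"
    and "(M * dpow d k z) $$ (i,j) = M $$ (i,j) * z powi k j"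
  using assms by (simp_all add: dpow_def scalar_prod_def if_distrib[of "\<lambda>x. x * c" for c]
      if_distrib[of "\<lambda>x. c * x" for c] cong: if_cong)

lemma dpow_transpose [simp]: "transpose_mat (dpow d k z) = dpow d k z"
  by (rule eq_matI) (auto simp: dpow_def)

context coefficient_field
begin

text \<open>\<open>H\<close> is \<open>Q\<close> times the inverse transpose of \<open>P\<close>.
  Using the adjugate gives the polynomial matrix \<open>N\<close>, which is \<open>det (P z)\<close>
  times \<open>H\<close>; skewness becomes a reflection identity for \<open>N\<close>, and
  \<open>dvd_of_reflection\<close> then shows that the determinant divides every entry.\<close>

lemma skew_factorization:
  assumes P: "P \<in> poly_mats d" "\<And>z. cmod z \<le> 1 \<Longrightarrow> det (P z) \<noteq> 0"
    and Q: "Q \<in> poly_mats d"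
    and skew: "\<And>z. z \<noteq> 0 \<Longrightarrow> transpose_mat (P (1 / z) * dpow d k (1 / z) * Q z) = - (P z * dpow d k z * Q (1 / z))"
  obtains H where "H \<in> poly_mats d" "\<And>z. H z * transpose_mat (P z) = Q z"
    "\<And>z i j. z \<noteq> 0 \<Longrightarrow> i < d \<Longrightarrow> j < d \<Longrightarrow> H z $$ (j,i) = - (z powi (k i + k j)) * H (1 / z) $$ (i,j)"
proof -
  note square = mult_carrier_mat[of _ d d _ d] assoc_mult_mat[of _ d d _ d _ d]
    transpose_mult[of _ d d _ d] mult_smult_assoc_mat[of _ d d _ d] mult_smult_distrib[of _ d d _ d]
  define R where "R z = adj_mat (P z)" for z
  define N where "N z = Q z * transpose_mat (R z)" for z
  have R: "R \<in> poly_mats d" unfolding R_def by (rule poly_mats_adj[OF P(1)])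
  have N: "N \<in> poly_mats d" unfolding N_def by (intro poly_mats_mult Q poly_mats_transpose R)
  have [simp]: "P z \<in> carrier_mat d d" "Q z \<in> carrier_mat d d" "R z \<in> carrier_mat d d" "N z \<in> carrier_mat d d" for z
    using P(1) Q R N by (auto intro: poly_mats_carrier)
  have dims: "dim_row (N z) = d" "dim_col (N z) = d" for z using N by (rule poly_mats_dim)+
  obtain p where p: "\<And>i. coeff p i \<in> F" "(\<lambda>z. det (P z)) = poly p"
    using polys_det[OF P(1)] by (rule polysE) blast
  have detP: "det (P z) = poly p z" for z using p(2) by metis
  have pnz: "poly p z \<noteq> 0" if "cmod z \<le> 1" for z using P(2)[OF that] by (simp add: detP)
  hence "p \<noteq> 0" by (metis norm_zero poly_0 zero_le_one)
  have RP: "R z * P z = poly p z \<cdot>\<^sub>m 1\<^sub>m d" for z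
    unfolding R_def using adj_mat(3)[of "P z" d] by (simp add: detP)
  \<comment> \<open>Congruence by the adjugate preserves skewness and turns the left factor
    \<open>P z\<close> into the scalar \<open>poly p z\<close>.\<close>
  define S where "S z = R z * (P z * dpow d k z * Q (1 / z)) * transpose_mat (R (1 / z))" for z
  have S: "S z = poly p z \<cdot>\<^sub>m (dpow d k z * N (1 / z))" for z
  proof -
    have "S z = (R z * P z) * (dpow d k z * N (1 / z))"
      unfolding S_def N_def by (simp add: square)
    thus ?thesis unfolding RP by (simp add: square)
  qed
  have Sskew: "transpose_mat (S (1 / z)) = - S z" if z: "z \<noteq> 0" for z
  proof -
    have "transpose_mat (S (1 / z)) = R z * (transpose_mat (P (1 / z) * dpow d k (1 / z) * Q z)) * transpose_mat (R (1 / z))"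
      unfolding S_def using z
      by (simp add: square)
    also have "\<dots> = - S z" unfolding skew[OF z] S_def
      by (simp add: square poly_mats_dim[OF P(1)] poly_mats_dim[OF Q] poly_mats_dim[OF R])
    finally show ?thesis .
  qed
  have Nrefl: "N z $$ (j,i) * poly p (1 / z) = - (z powi (k i + k j)) * poly p z * N (1 / z) $$ (i,j)"
    if z: "z \<noteq> 0" and ij: "i < d" "j < d" for z i j
  proof -
    have "S (1 / z) $$ (j,i) = - S z $$ (i,j)"
      using arg_cong[OF Sskew[OF z], of "\<lambda>M. M $$ (i,j)"] ij by (simp add: S dims)
    hence "poly p (1 / z) * ((1 / z) powi k j * N z $$ (j,i)) = - (poly p z * (z powi k i * N (1 / z) $$ (i,j)))"
      using ij by (simp add: S dims dpow_mult_entry[where d = d] del: index_mult_mat(1))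
    moreover have "z powi k j * (1 / z) powi k j = 1" using z by (simp flip: power_int_mult_distrib)
    hence "N z $$ (j,i) * poly p (1 / z) = z powi k j * (poly p (1 / z) * ((1 / z) powi k j * N z $$ (j,i)))"
      by (simp add: mult_ac)
    ultimately show ?thesis using z by (simp add: power_int_add mult_ac)
  qed
  have "\<exists>h. (\<forall>z. N z $$ (j,i) = poly p z * poly h z) \<and> poly h \<in> polys" if ij: "i < d" "j < d" for i j
  proof -
    obtain n where n: "\<And>r. coeff n r \<in> F" "(\<lambda>z. N z $$ (j,i)) = poly n"
      using poly_mats_entry[OF N ij(2,1)] by (rule polysE) blast
    obtain m where m: "(\<lambda>z. N z $$ (i,j)) = poly m"
      using poly_mats_entry[OF N ij] by (rule polysE) blast
    have nm: "N z $$ (j,i) = poly n z" "N z $$ (i,j) = poly m z" for z using n(2) m by metis+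
    have "p dvd n" by (rule dvd_of_reflection[OF pnz Nrefl[OF _ ij, unfolded nm]])
    then obtain h where h: "n = p * h" by blast
    have "poly h \<in> polys" using p(1) \<open>p \<noteq> 0\<close> n(1)[unfolded h] by (rule polys_quotient)
    with h nm show ?thesis by (intro exI[of _ h]) auto
  qed
  note ex = this
  define h where "h j i = (SOME h. (\<forall>z. N z $$ (j,i) = poly p z * poly h z) \<and> poly h \<in> polys)" for j i
  have h: "N z $$ (j,i) = poly p z * poly (h j i) z" "poly (h j i) \<in> polys" if "i < d" "j < d" for i j z
    using someI_ex[OF ex[OF that]] unfolding h_def by blast+
  define H where "H z = mat d d (\<lambda>(i,j). poly (h i j) z)" for z
  have H: "H \<in> poly_mats d"
    by (rule poly_matsI) (auto simp: H_def h(2))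
  have [simp]: "H z \<in> carrier_mat d d" for z by (simp add: H_def)
  have NH: "N z = poly p z \<cdot>\<^sub>m H z" for z
    by (rule eq_matI) (auto simp: H_def h(1) dims)
  show ?thesis
  proof (rule that[OF H])
    fix z :: complex
    have smult: "poly p z \<cdot>\<^sub>m (H z * transpose_mat (P z)) = poly p z \<cdot>\<^sub>m Q z" for z
    proof -
      have "poly p z \<cdot>\<^sub>m (H z * transpose_mat (P z)) = N z * transpose_mat (P z)"
        unfolding NH by (simp add: square)
      also have "\<dots> = Q z * transpose_mat (P z * R z)"
        unfolding N_def by (simp add: square)
      also have "P z * R z = poly p z \<cdot>\<^sub>m 1\<^sub>m d"
        unfolding R_def using adj_mat(2)[of "P z" d] by (simp add: detP)
      also have "transpose_mat (poly p z \<cdot>\<^sub>m 1\<^sub>m d) = poly p z \<cdot>\<^sub>m 1\<^sub>m d"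
        by (rule eq_matI) auto
      finally show ?thesis by (simp add: square right_mult_one_mat[of _ d d])
    qed
    have HP: "(\<lambda>z. H z * transpose_mat (P z)) \<in> poly_mats d"
      by (intro poly_mats_mult H poly_mats_transpose P)
    show "H z * transpose_mat (P z) = Q z"
    proof (rule eq_matI)
      fix i j assume "i < dim_row (Q z)" "j < dim_col (Q z)"
      hence ij: "i < d" "j < d" using Q by (auto simp: poly_mats_dim)
      obtain u where u: "(\<lambda>z. (H z * transpose_mat (P z)) $$ (i,j)) = poly u"
        using poly_mats_entry[OF HP ij] by (rule polysE) blast
      obtain v where v: "(\<lambda>z. Q z $$ (i,j)) = poly v"
        using poly_mats_entry[OF Q ij] by (rule polysE) blast
      have uv: "(H z * transpose_mat (P z)) $$ (i,j) = poly u z" "Q z $$ (i,j) = poly v z" for z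
        using u v by metis+
      \<comment> \<open>Cancelling \<open>p\<close> between polynomials gives the identity also at
        the zeros of \<open>p\<close>.\<close>
      have "p * u = p * v"
      proof (rule poly_eqI_nonzero)
        fix z
        show "poly (p * u) z = poly (p * v) z"
          using arg_cong[OF smult[of z], of "\<lambda>M. M $$ (i,j)"] ij poly_mats_dim[OF Q] poly_mats_dim[OF HP]
          by (simp add: uv del: index_mult_mat(1))
      qed
      hence "u = v" using \<open>p \<noteq> 0\<close> by simp
      thus "(H z * transpose_mat (P z)) $$ (i,j) = Q z $$ (i,j)" using uv by simp
    qed (use poly_mats_dim[OF Q] poly_mats_dim[OF HP] in auto)
  next
    fix z :: complex and i j assume z: "z \<noteq> 0" and ij: "i < d" "j < d"
    have "poly (h j i) z = - (z powi (k i + k j)) * poly (h i j) (1 / z)"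
    proof (rule reflection_cancel[OF \<open>p \<noteq> 0\<close> _ z])
      fix z :: complex assume "z \<noteq> 0"
      from Nrefl[OF this ij] show "poly p z * poly p (1 / z) * poly (h j i) z
          = poly p z * poly p (1 / z) * (- (z powi (k i + k j)) * poly (h i j) (1 / z))"
        using ij by (simp add: h(1) mult_ac)
    qed
    thus "H z $$ (j,i) = - (z powi (k i + k j)) * H (1 / z) $$ (i,j)"
      using ij by (simp add: H_def)
  qed
qed

end

section \<open>Symmetry of the partial indices\<close>

text \<open>The reflection identity says that \<open>dpow d k z * H (1 / z)\<close> is skew. The
  determinant is assumed nonzero in the closed disc only, since only there are \<open>P\<close> and
  \<open>Q\<close> known to be invertible.\<close>

locale skew_kernel = coefficient_field +
  fixes d :: nat and k :: "nat \<Rightarrow> int" and H :: "complex \<Rightarrow> complex mat"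
  assumes H: "H \<in> poly_mats d"
    and reflection: "\<And>z i j. z \<noteq> 0 \<Longrightarrow> i < d \<Longrightarrow> j < d \<Longrightarrow>
      H z $$ (j,i) = - (z powi (k i + k j)) * H (1 / z) $$ (i,j)"
    and det_H: "\<And>z. cmod z \<le> 1 \<Longrightarrow> det (H z) \<noteq> 0"
    and antimono: "\<And>i j. i \<le> j \<Longrightarrow> j < d \<Longrightarrow> k j \<le> k i"
begin

lemma H_carrier [simp]: "H z \<in> carrier_mat d d"
  and H_dim [simp]: "dim_row (H z) = d" "dim_col (H z) = d"
  using H by (rule poly_mats_carrier poly_mats_dim)+

text \<open>The reflection identity caps the degree of entry \<open>(i,j)\<close> at
  \<open>k i + k j\<close>.\<close>

lemma H_entry:
  assumes ij: "i < d" "j < d"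
  shows "k i + k j < 0 \<Longrightarrow> H z $$ (i,j) = 0" "k i + k j = 0 \<Longrightarrow> H z $$ (i,j) = H 0 $$ (i,j)"
proof -
  obtain h where h: "(\<lambda>z. H z $$ (i,j)) = poly h"
    using poly_mats_entry[OF H ij] by (rule polysE) blast
  obtain m where m: "(\<lambda>z. H z $$ (j,i)) = poly m"
    using poly_mats_entry[OF H ij(2,1)] by (rule polysE) blast
  have hm: "H z $$ (i,j) = poly h z" "H z $$ (j,i) = poly m z" for z using h m by metis+
  have *: "h = [:if k i + k j = 0 then coeff h 0 else 0:]" if "k i + k j \<le> 0"
  proof (rule reflection_degree[OF _ that])
    show "poly h z = - (z powi (k i + k j)) * poly m (1 / z)" if "z \<noteq> 0" for z
      using reflection[OF that ij(2,1)] by (simp add: hm add.commute)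
  qed
  have "poly h z = poly [:if k i + k j = 0 then coeff h 0 else 0:] z" if "k i + k j \<le> 0" for z
    using *[OF that] by simp
  thus "k i + k j < 0 \<Longrightarrow> H z $$ (i,j) = 0" "k i + k j = 0 \<Longrightarrow> H z $$ (i,j) = H 0 $$ (i,j)"
    unfolding hm by auto
qed

text \<open>In matrix form the reflection identity says that the transpose of \<open>H z\<close> is
  minus \<open>H (1 / z)\<close> multiplied on both sides by \<open>dpow d k z\<close>; now take
  determinants.\<close>

lemma det_reflection:
  assumes z: "z \<noteq> 0"
  shows "det (H z) = (-1) ^ d * (\<Prod>i<d. z powi k i)\<^sup>2 * det (H (1 / z))"
proof -
  have "transpose_mat (H z) = (-1) \<cdot>\<^sub>m (dpow d k z * (H (1 / z) * dpow d k z))"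
  proof (rule eq_matI)
    fix i j assume "i < dim_row ((-1) \<cdot>\<^sub>m (dpow d k z * (H (1 / z) * dpow d k z)))"
      "j < dim_col ((-1) \<cdot>\<^sub>m (dpow d k z * (H (1 / z) * dpow d k z)))"
    hence ij: "i < d" "j < d" by auto
    have "(dpow d k z * (H (1 / z) * dpow d k z)) $$ (i,j) = z powi k i * (H (1 / z) $$ (i,j) * z powi k j)"
      using ij by (simp add: dpow_mult_entry[where d = d] mult_carrier_mat[of _ d d _ d] del: index_mult_mat(1))
    moreover have "H z $$ (j,i) = - (z powi k i * (H (1 / z) $$ (i,j) * z powi k j))"
      unfolding reflection[OF z ij] using z by (simp add: power_int_add)
    ultimately show "transpose_mat (H z) $$ (i,j) = ((-1) \<cdot>\<^sub>m (dpow d k z * (H (1 / z) * dpow d k z))) $$ (i,j)"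
      using ij by (simp del: index_mult_mat(1))
  qed simp_all
  hence "det (transpose_mat (H z)) = (-1) ^ d * (det (dpow d k z) * (det (H (1 / z)) * det (dpow d k z)))"
    by (simp add: det_mult[of _ d] mult_carrier_mat[of _ d d _ d])
  also have "det (transpose_mat (H z)) = det (H z)" by (rule det_transpose[OF H_carrier])
  also have "det (dpow d k z) = (\<Prod>i<d. z powi k i)"
  proof -
    have "det (dpow d k z) = prod_list (diag_mat (dpow d k z))"
      by (rule det_upper_triangular[of _ d]) (auto simp: dpow_def)
    also have "diag_mat (dpow d k z) = map (\<lambda>i. z powi k i) [0..<d]"
      by (auto simp: diag_mat_def dpow_def)
    finally show ?thesis by (simp add: prod.list_conv_set_nth lessThan_atLeast0)
  qed
  finally show ?thesis by (simp add: power2_eq_square mult_ac)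
qed

text \<open>Zeros outside the disc are excluded by reflecting into it, so the determinant is a
  polynomial without zeros.\<close>

lemma det_H_const: "det (H z) = det (H 0)"
proof -
  obtain u where "(\<lambda>z. det (H z)) = poly u"
    using polys_det[OF H] by (rule polysE) blast
  hence u: "det (H z) = poly u z" for z by metis
  have "poly u z \<noteq> 0" for z
  proof (cases "cmod z \<le> 1")
    case False
    hence "z \<noteq> 0" "cmod (1 / z) \<le> 1" by (auto simp: norm_divide divide_le_eq_1)
    thus ?thesis using det_H[of "1 / z"] det_reflection[of z] by (simp add: u)
  qed (use det_H u in metis)
  with fundamental_theorem_of_algebra_alt[of u] obtain c where "u = [:c:]" by blast
  thus ?thesis by (simp add: u)
qed

text \<open>At \<open>z = 2\<close> the equal determinants cancel from
  \<open>det_reflection\<close>, leaving a power of 2 that equals 1 up to sign.\<close>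

lemma sum_k: "(\<Sum>i<d. k i) = 0"
proof -
  have "det (H 0) \<noteq> 0" by (rule det_H) simp
  moreover have "det (H 0) = (-1) ^ d * (\<Prod>i<d. 2 powi k i)\<^sup>2 * det (H 0)"
    using det_reflection[of 2] det_H_const[of 2] det_H_const[of "1/2"] by simp
  ultimately have "(-1) ^ d * (\<Prod>i<d. (2::complex) powi k i)\<^sup>2 = 1" by simp
  moreover have "(\<Prod>i<d. (2::complex) powi k i) = 2 powi (\<Sum>i<d. k i)"
    by (induction d) (auto simp: power_int_add)
  ultimately have "cmod ((-1) ^ d * (2 powi (\<Sum>i<d. k i))\<^sup>2) = 1" by simp
  hence "(2 powi (\<Sum>i<d. k i) :: real) ^ 2 = 1 ^ 2"
    by (simp add: norm_mult norm_power norm_power_int)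
  moreover have "(0::real) \<le> 2 powi (\<Sum>i<d. k i)" by simp
  ultimately have "(2 powi (\<Sum>i<d. k i) :: real) = 1" unfolding power2_eq_iff by linarith
  thus ?thesis
    using one_less_power[of "2::real" "nat (\<Sum>i<d. k i)"] power_strict_decreasing[of 0 "nat (- (\<Sum>i<d. k i))" "1 / 2 :: real"]
    by (cases "\<Sum>i<d. k i" "0::int" rule: linorder_cases) (auto simp: power_int_def inverse_eq_divide)
qed

lemma sum_k_permutes: "p permutes {0..<d} \<Longrightarrow> (\<Sum>i = 0..<d. k i + k (p i)) = 0"
  using sum_k sum.permute[of p "{0..<d}" k] by (simp add: sum.distrib lessThan_atLeast0 comp_def)

text \<open>Some Leibniz term of \<open>det (H 0)\<close> is nonzero. Along it every
  \<open>k i + k (p i)\<close> is nonnegative by \<open>H_entry\<close>, and these numbers sum to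
  0.\<close>

lemma obtain_pairing:
  obtains p where "p permutes {0..<d}" "\<And>i. i < d \<Longrightarrow> k (p i) = - k i"
proof -
  have "\<exists>p. p permutes {0..<d} \<and> (\<Prod>i = 0..<d. H 0 $$ (i, p i)) \<noteq> 0"
  proof (rule ccontr)
    assume "\<not> ?thesis"
    hence "det (H 0) = 0" unfolding det_def'[OF H_carrier] by (intro sum.neutral) auto
    thus False using det_H[of 0] by simp
  qed
  then obtain p where p: "p permutes {0..<d}" "\<And>i. i < d \<Longrightarrow> H 0 $$ (i, p i) \<noteq> 0" by auto
  have "0 \<le> k i + k (p i)" if "i \<in> {0..<d}" for i
    using that p(2)[of i] H_entry(1)[of i "p i" 0] permutes_in_image[OF p(1), of i] by force
  with sum_k_permutes[OF p(1)] have "\<forall>i\<in>{0..<d}. k i + k (p i) = 0"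
    by (subst (asm) sum_nonneg_eq_0_iff) auto
  with p(1) show ?thesis by (intro that[of p]) (auto simp: add_eq_0_iff)
qed

text \<open>Pigeonhole: \<open>p\<close> negates the sorted indices, so a failure would let
  \<open>p\<close> inject the \<open>d - i\<close> positions from \<open>i\<close> on into the first
  \<open>d - 1 - i\<close>, or the first \<open>i + 1\<close> positions into the last
  \<open>i\<close>.\<close>

lemma symmetric:
  assumes i: "i < d"
  shows "k (d - 1 - i) = - k i"
proof -
  obtain p where p: "p permutes {0..<d}" "\<And>i. i < d \<Longrightarrow> k (p i) = - k i" by (rule obtain_pairing) blast
  have inj: "inj_on p X" for X using permutes_inj[OF p(1)] by (rule inj_on_subset) simp
  have pd: "p j < d" if "j < d" for j using permutes_in_image[OF p(1), of j] that by simp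
  have "\<not> k (d - 1 - i) < - k i"
  proof
    assume less: "k (d - 1 - i) < - k i"
    have "p ` {i..<d} \<subseteq> {0..<d - 1 - i}"
    proof (rule image_subsetI)
      fix j assume j: "j \<in> {i..<d}"
      have "k (d - 1 - i) < k (p j)" using p(2)[of j] antimono[of i j] j less by simp
      hence "\<not> d - 1 - i \<le> p j" using antimono[of "d - 1 - i" "p j"] pd[of j] j by auto
      thus "p j \<in> {0..<d - 1 - i}" by simp
    qed
    hence "card (p ` {i..<d}) \<le> card {0..<d - 1 - i}" by (intro card_mono) auto
    thus False using i by (simp add: card_image[OF inj])
  qed
  moreover have "\<not> - k i < k (d - 1 - i)"
  proof
    assume less: "- k i < k (d - 1 - i)"
    have "p ` {..i} \<subseteq> {d - i..<d}"
    proof (rule image_subsetI)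
      fix j assume j: "j \<in> {..i}"
      have "k (p j) < k (d - 1 - i)" using p(2)[of j] antimono[of j i] j less i by simp
      hence "\<not> p j \<le> d - 1 - i" using antimono[of "p j" "d - 1 - i"] i by auto
      thus "p j \<in> {d - i..<d}" using pd[of j] j i by auto
    qed
    hence "card (p ` {..i}) \<le> card {d - i..<d}" by (intro card_mono) auto
    thus False using i by (simp add: card_image[OF inj])
  qed
  ultimately show ?thesis by simp
qed

section \<open>The constant blocks and the reduction to them\<close>

definition h :: "complex mat" where
  "h = mat d d (\<lambda>(i,j). if k i + k j = 0 then H 0 $$ (i,j) else 0)"

lemma h_carrier [simp]: "h \<in> carrier_mat d d"
  by (simp add: h_def)

lemma h_dim [simp]: "dim_row h = d" "dim_col h = d"
  by (simp_all add: h_def)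

text \<open>Where \<open>k i + k j = 0\<close> the entry of \<open>H\<close> is constant, so
  skewness can be read off at \<open>z = 1\<close>. The determinants of \<open>h\<close> and
  \<open>H 0\<close> agree term by term: either all \<open>k i + k (p i)\<close> vanish, or one is
  negative and both products are 0.\<close>

lemma graded_skew_h: "graded_skew d k h"
proof -
  have "det h = det (H 0)"
    unfolding det_def'[OF h_carrier] det_def'[OF H_carrier]
  proof (intro sum.cong refl arg_cong2[of _ _ _ _ "(*)"])
    fix p assume "p \<in> {p. p permutes {0..<d}}"
    hence p: "p permutes {0..<d}" by simp
    have pd: "p i < d" if "i < d" for i using permutes_in_image[OF p, of i] that by simp
    show "(\<Prod>i = 0..<d. h $$ (i, p i)) = (\<Prod>i = 0..<d. H 0 $$ (i, p i))"
    proof (cases "\<forall>i\<in>{0..<d}. 0 \<le> k i + k (p i)")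
      case True
      with sum_k_permutes[OF p] have "\<forall>i\<in>{0..<d}. k i + k (p i) = 0"
        by (subst (asm) sum_nonneg_eq_0_iff) auto
      thus ?thesis by (intro prod.cong) (auto simp: h_def pd)
    next
      case False
      then obtain i where i: "i \<in> {0..<d}" "k i + k (p i) < 0" by force
      hence "h $$ (i, p i) = 0" "H 0 $$ (i, p i) = 0"
        using H_entry(1)[of i "p i" 0] by (auto simp: h_def pd)
      with i(1) have "(\<Prod>i = 0..<d. h $$ (i, p i)) = 0" "(\<Prod>i = 0..<d. H 0 $$ (i, p i)) = 0"
        by (auto intro!: prod_zero)
      thus ?thesis by (rule trans[OF _ sym])
    qed
  qed
  hence "det h \<noteq> 0" using det_H[of 0] by simp
  moreover have "h $$ (i,j) \<in> F" if ij: "i < d" "j < d" for i j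
    using ij closed(1) polys_at_0[OF poly_mats_entry[OF H ij]] by (simp add: h_def)
  moreover have "h $$ (j,i) = - h $$ (i,j)" if ij: "i < d" "j < d" for i j
    using reflection[of 1 i j] H_entry(2)[OF ij, of 1] H_entry(2)[OF ij(2,1), of 1] ij
    by (auto simp: h_def add.commute)
  moreover have "k i + k j = 0" if "i < d" "j < d" "h $$ (i,j) \<noteq> 0" for i j
    using that by (auto simp: h_def split: if_splits)
  ultimately show ?thesis unfolding graded_skew_def using h_carrier by blast
qed

text \<open>The minus sign absorbs the one in the reflection identity when \<open>Y z * B0 z\<close>
  is computed later.\<close>

lemma obtain_neg_inverse:
  obtains g where "g \<in> carrier_mat d d" "g * h = - 1\<^sub>m d"
    "\<And>i j. i < d \<Longrightarrow> j < d \<Longrightarrow> g $$ (i,j) \<in> F"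
    "\<And>i j. i < d \<Longrightarrow> j < d \<Longrightarrow> g $$ (i,j) \<noteq> 0 \<Longrightarrow> k i + k j = 0"
proof -
  have det: "det h \<noteq> 0" using graded_skew_h by (rule graded_skew_det)
  have hF: "h $$ (i,j) \<in> F" if "i < d" "j < d" for i j
    using graded_skew_entry(1)[OF graded_skew_h that] .
  have const: "(\<lambda>_. h) \<in> poly_mats d" by (rule poly_mats_const) (simp_all add: hF)
  have adjF: "adj_mat h $$ (i,j) \<in> F" if "i < d" "j < d" for i j
    using polys_at_0[OF poly_mats_entry[OF poly_mats_adj[OF const] that]] .
  have detF: "det h \<in> F" using polys_at_0[OF polys_det[OF const]] .
  have adj: "adj_mat h \<in> carrier_mat d d" "h * adj_mat h = det h \<cdot>\<^sub>m 1\<^sub>m d"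
    using adj_mat[OF h_carrier] by auto
  text \<open>The part of \<open>h\<inverse>\<close> outside the blocks \<open>k i + k j = 0\<close> contributes nothing to \<open>h * h\<inverse>\<close>,
    so it may be dropped without computing it.\<close>
  define g where "g = mat d d (\<lambda>(i,j). if k i + k j = 0 then - (adj_mat h $$ (i,j) / det h) else 0)"
  have g: "g \<in> carrier_mat d d" by (simp add: g_def)
  have "h * (- g) = 1\<^sub>m d"
  proof (rule eq_matI)
    fix i j assume "i < dim_row (1\<^sub>m d)" "j < dim_col (1\<^sub>m d)"
    hence ij: "i < d" "j < d" by auto
    have "(h * (- g)) $$ (i,j) = (\<Sum>l = 0..<d. h $$ (i,l) * - g $$ (l,j))"
      using ij g by (auto simp: scalar_prod_def sum_negf)
    also have "\<dots> = (\<Sum>l = 0..<d. if k i = k j then h $$ (i,l) * adj_mat h $$ (l,j) / det h else 0)"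
      using ij by (intro sum.cong) (auto simp: g_def h_def)
    also have "\<dots> = (if k i = k j then (\<Sum>l = 0..<d. h $$ (i,l) * adj_mat h $$ (l,j)) / det h else 0)"
      by (simp add: sum_divide_distrib)
    also have "(\<Sum>l = 0..<d. h $$ (i,l) * adj_mat h $$ (l,j)) = (h * adj_mat h) $$ (i,j)"
      using ij adj(1) by (auto simp: scalar_prod_def)
    also have "\<dots> = (if i = j then det h else 0)" unfolding adj(2) using ij by simp
    finally show "(h * (- g)) $$ (i,j) = 1\<^sub>m d $$ (i,j)" using ij det by simp
  qed (use g in auto)
  hence "(- g) * h = 1\<^sub>m d"
    using mat_mult_left_right_inverse[OF h_carrier, of "- g"] g by simp
  hence "- (g * h) = 1\<^sub>m d" using g by simp
  hence "g * h = - 1\<^sub>m d" by (metis uminus_uminus_mat)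
  thus ?thesis
  proof (rule that[OF g])
    show "g $$ (i,j) \<in> F" if "i < d" "j < d" for i j
    proof -
      have "- (adj_mat h $$ (i,j) / det h) \<in> F" by (intro closed adjF detF that)
      thus ?thesis using that closed(1) by (simp add: g_def)
    qed
    show "k i + k j = 0" if "i < d" "j < d" "g $$ (i,j) \<noteq> 0" for i j
      using that by (auto simp: g_def split: if_splits)
  qed
qed

text \<open>Writing \<open>B = D h + N\<close> with \<open>N\<close> supported on \<open>k i + k j > 0\<close>, one splits \<open>N = M - M\<^sup>T\<close> with
  \<open>M\<close> supported on columns of positive index. Then \<open>U = 1 + M (D h)\<inverse>\<close> is polynomial and
  unipotent, and the quadratic term \<open>M (D h)\<inverse> M\<^sup>T\<close> vanishes because \<open>(D h)\<inverse>\<close> pairs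
  columns of opposite index.\<close>

lemma reduce_to_constant:
  obtains U where "U \<in> poly_mats d" "\<And>z. det (U z) = 1"
    "\<And>z. z \<noteq> 0 \<Longrightarrow> dpow d k z * H (1 / z) = U z * (dpow d k z * h) * transpose_mat (U (1 / z))"
proof -
  obtain g where g: "g \<in> carrier_mat d d" "g * h = - 1\<^sub>m d"
    "\<And>i j. i < d \<Longrightarrow> j < d \<Longrightarrow> g $$ (i,j) \<in> F"
    "\<And>i j. i < d \<Longrightarrow> j < d \<Longrightarrow> g $$ (i,j) \<noteq> 0 \<Longrightarrow> k i + k j = 0"
    by (rule obtain_neg_inverse) blast
  \<comment> \<open>Weights of the splitting, so that \<open>M\<close> has entries
    \<open>w i j * B z $$ (i,j)\<close>. Two positive indices share equally; otherwise the whole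
    weight goes to the column of positive index.\<close>
  define w :: "nat \<Rightarrow> nat \<Rightarrow> complex" where
    "w i j = (if 0 < k j \<and> 0 < k i + k j then if 0 < k i then 1 / 2 else 1 else 0)" for i j
  \<comment> \<open>\<open>M\<close> is minus \<open>W z\<close> times
    \<open>dpow d k (1 / z)\<close>. These powers cancel in the product of \<open>M\<close> with the
    inverse of \<open>D h\<close>, so \<open>Y\<close> is polynomial.\<close>
  define W where "W z = mat d d (\<lambda>(i,j). w i j * H z $$ (j,i))" for z
  define Y where "Y z = W z * g" for z
  define U where "U z = mat d d (\<lambda>(i,j). (if i = j then 1 else 0) + Y z $$ (i,j))" for z
  have [simp]: "W z \<in> carrier_mat d d" "Y z \<in> carrier_mat d d" "U z \<in> carrier_mat d d" for z
    using g(1) by (auto simp: W_def Y_def U_def intro!: mult_carrier_mat[of _ d d _ d])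
  have [simp]: "dim_row (Y z) = d" "dim_col (Y z) = d" "dim_row (U z) = d" "dim_col (U z) = d" for z
    using g(1) by (auto simp: Y_def W_def U_def)
  have wF: "w i j \<in> F" for i j
    using closed(1,2) F by (auto simp: w_def)
  have W: "W \<in> poly_mats d"
    by (rule poly_matsI) (auto simp: W_def intro!: polys_mult polys_const wF poly_mats_entry[OF H])
  have Y: "Y \<in> poly_mats d"
    unfolding Y_def by (intro poly_mats_mult W poly_mats_const g)
  have U: "U \<in> poly_mats d"
    by (rule poly_matsI) (auto simp: U_def intro!: polys_add polys_const closed(1,2) poly_mats_entry[OF Y])
  \<comment> \<open>As the indices are sorted, \<open>k j < k i\<close> forces \<open>i < j\<close>,
    so \<open>U\<close> is unipotent upper triangular; \<open>k j < 0\<close> will remove the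
    quadratic term.\<close>
  have Ynz: "k j < 0 \<and> k j < k i" if ij: "i < d" "j < d" and nz: "Y z $$ (i,j) \<noteq> 0" for z i j
  proof -
    have "Y z $$ (i,j) = (\<Sum>l = 0..<d. W z $$ (i,l) * g $$ (l,j))"
      using ij g(1) by (auto simp: Y_def W_def scalar_prod_def)
    with nz have "(\<Sum>l = 0..<d. W z $$ (i,l) * g $$ (l,j)) \<noteq> 0" by simp
    then obtain l where l: "l \<in> {0..<d}" "W z $$ (i,l) * g $$ (l,j) \<noteq> 0"
      by (rule sum.not_neutral_contains_not_neutral)
    hence "k l + k j = 0" using g(4)[of l j] ij by auto
    moreover have "w i l \<noteq> 0" using l ij by (auto simp: W_def)
    hence "0 < k l" "0 < k i + k l" by (auto simp: w_def split: if_splits)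
    ultimately show ?thesis by auto
  qed
  have detU: "det (U z) = 1" for z
  proof -
    have "Y z $$ (i,i) = 0" if "i < d" for i using Ynz[OF that that, of z] by blast
    hence diag: "diag_mat (U z) = map (\<lambda>_. 1) [0..<d]"
      by (auto simp: diag_mat_def U_def)
    have "upper_triangular (U z)"
    proof (rule upper_triangularI)
      fix i j assume "j < i" "i < dim_row (U z)"
      hence ij: "i < d" "j < d" "j < i" by auto
      show "U z $$ (i,j) = 0"
        using ij Ynz[OF ij(1,2), of z] antimono[of j i] by (auto simp: U_def)
    qed
    hence "det (U z) = prod_list (diag_mat (U z))" by (rule det_upper_triangular[of _ d]) simp
    thus ?thesis unfolding diag by (simp add: map_replicate_const)
  qed
  define B0 where "B0 z = dpow d k z * h" for z
  define B where "B z = dpow d k z * H (1 / z)" for z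
  have [simp]: "B0 z \<in> carrier_mat d d" "B z \<in> carrier_mat d d" for z
    by (auto simp: B0_def B_def intro!: mult_carrier_mat[of _ d d _ d])
  have [simp]: "dim_row (B0 z) = d" "dim_col (B0 z) = d" "dim_row (B z) = d" "dim_col (B z) = d" for z
    by (auto simp: B0_def B_def)
  have B0: "B0 z $$ (i,j) = z powi k i * h $$ (i,j)" if "i < d" "j < d" for z i j
    using that by (simp add: B0_def dpow_mult_entry[where d = d] del: index_mult_mat(1))
  have B: "B z $$ (i,j) = z powi k i * H (1 / z) $$ (i,j)" if "i < d" "j < d" for z i j
    using that by (simp add: B_def dpow_mult_entry[where d = d] del: index_mult_mat(1))
  have inv: "(1 / z) powi n = z powi (- n)" for z :: complex and n
    by (simp add: power_int_minus power_int_divide_distrib inverse_eq_divide)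
  \<comment> \<open>Reflection moves the power of \<open>z\<close> from the row to the
    column.\<close>
  have B': "B z $$ (i,j) = - (z powi (- k j) * H z $$ (j,i))" if z: "z \<noteq> 0" and ij: "i < d" "j < d" for z i j
    using ij z by (simp add: B reflection[OF z ij] flip: power_int_add mult.assoc)
  have B0': "B0 z $$ (i,j) = z powi (- k j) * h $$ (i,j)" if ij: "i < d" "j < d" for z i j
    using graded_skew_entry(3)[OF graded_skew_h ij]
    by (cases "h $$ (i,j) = 0") (auto simp: B0[OF ij] add_eq_0_iff)
  have Bskew: "B (1 / z) $$ (j,i) = - B z $$ (i,j)" if z: "z \<noteq> 0" and ij: "i < d" "j < d" for z i j
    using ij z by (simp add: B'[OF z ij] B[OF ij(2,1)] inv)
  have B0skew: "B0 (1 / z) $$ (j,i) = - B0 z $$ (i,j)" if ij: "i < d" "j < d" for z i j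
    using graded_skew_entry(2)[OF graded_skew_h ij]
    by (simp add: B0'[OF ij] B0[OF ij(2,1)] inv)
  have YB0: "(Y z * B0 z) $$ (i,j) = w i j * B z $$ (i,j)" if z: "z \<noteq> 0" and ij: "i < d" "j < d" for z i j
  proof -
    \<comment> \<open>\<open>h\<close> pairs opposite indices, so \<open>D\<close> passes to its
      right as the inverse of \<open>D\<close>.\<close>
    have "B0 z = h * dpow d k (1 / z)"
      by (rule eq_matI) (auto simp: B0' dpow_mult_entry[where d = d] inv mult.commute simp del: index_mult_mat(1))
    hence "Y z * B0 z = W z * ((g * h) * dpow d k (1 / z))"
      using g(1) unfolding Y_def
      by (simp add: mult_carrier_mat[of _ d d _ d] assoc_mult_mat[of _ d d _ d _ d])
    also have "\<dots> = - (W z * dpow d k (1 / z))"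
      unfolding g(2) by (simp add: left_mult_one_mat[of _ d d] W_def)
    finally have "(Y z * B0 z) $$ (i,j) = - (W z $$ (i,j) * z powi (- k j))"
      using ij by (simp add: dpow_mult_entry[where d = d] inv W_def[abs_def] del: index_mult_mat(1))
    thus ?thesis using ij by (simp add: W_def B'[OF z ij])
  qed
  show ?thesis
  proof (rule that[OF U detU])
    fix z :: complex assume z: "z \<noteq> 0"
    hence z': "1 / z \<noteq> 0" by simp
    have UX: "(U z * X) $$ (i,j) = X $$ (i,j) + (Y z * X) $$ (i,j)"
      if "X \<in> carrier_mat d d" "i < d" "j < d" for X z i j
    proof -
      have "(U z * X) $$ (i,j) = (\<Sum>l = 0..<d. (if i = l then X $$ (l,j) else 0) + Y z $$ (i,l) * X $$ (l,j))"
        using that by (auto simp: U_def scalar_prod_def algebra_simps intro!: sum.cong)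
      thus ?thesis using that by (auto simp: sum.distrib scalar_prod_def)
    qed
    have XU: "(X * transpose_mat (U z)) $$ (i,j) = X $$ (i,j) + (\<Sum>l = 0..<d. X $$ (i,l) * Y z $$ (j,l))"
      if "X \<in> carrier_mat d d" "i < d" "j < d" for X z i j
    proof -
      have "(X * transpose_mat (U z)) $$ (i,j) = (\<Sum>l = 0..<d. (if j = l then X $$ (i,l) else 0) + X $$ (i,l) * Y z $$ (j,l))"
        using that by (auto simp: U_def scalar_prod_def algebra_simps intro!: sum.cong)
      thus ?thesis using that by (simp add: sum.distrib)
    qed
    have "B z = U z * B0 z * transpose_mat (U (1 / z))"
    proof (rule eq_matI)
      fix i j assume "i < dim_row (U z * B0 z * transpose_mat (U (1 / z)))"
        "j < dim_col (U z * B0 z * transpose_mat (U (1 / z)))"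
      hence ij: "i < d" "j < d" by auto
      have UB: "(U z * B0 z) $$ (i,l) = B0 z $$ (i,l) + w i l * B z $$ (i,l)" if "l < d" for l
        using that ij z by (simp add: UX YB0 del: index_mult_mat(1))
      have "(U z * B0 z * transpose_mat (U (1 / z))) $$ (i,j)
          = (U z * B0 z) $$ (i,j) + (\<Sum>l = 0..<d. (U z * B0 z) $$ (i,l) * Y (1 / z) $$ (j,l))"
        using ij by (intro XU mult_carrier_mat[of _ d d _ d]) simp_all
      also have "(\<Sum>l = 0..<d. (U z * B0 z) $$ (i,l) * Y (1 / z) $$ (j,l))
          = (\<Sum>l = 0..<d. - (Y (1 / z) $$ (j,l) * B0 (1 / z) $$ (l,i)))"
      proof (rule sum.cong[OF refl])
        fix l assume "l \<in> {0..<d}"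
        hence l: "l < d" by simp
        \<comment> \<open>The quadratic term: the weight requires \<open>0 < k l\<close>, the entry
          of \<open>Y\<close> requires \<open>k l < 0\<close>.\<close>
        have "w i l = 0 \<or> Y (1 / z) $$ (j,l) = 0"
          using Ynz[OF ij(2) l, of "1 / z"] by (cases "Y (1 / z) $$ (j,l) = 0") (auto simp: w_def)
        thus "(U z * B0 z) $$ (i,l) * Y (1 / z) $$ (j,l) = - (Y (1 / z) $$ (j,l) * B0 (1 / z) $$ (l,i))"
          by (auto simp: UB[OF l] B0skew[OF ij(1) l] mult.commute simp del: index_mult_mat(1))
      qed
      also have "\<dots> = - (Y (1 / z) * B0 (1 / z)) $$ (j,i)"
        using ij by (simp add: scalar_prod_def sum_negf)
      also have "\<dots> = w j i * B z $$ (i,j)"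
        unfolding YB0[OF z' ij(2,1)] Bskew[OF z ij] by simp
      finally have "(U z * B0 z * transpose_mat (U (1 / z))) $$ (i,j) = B0 z $$ (i,j) + (w i j + w j i) * B z $$ (i,j)"
        by (simp add: UB[OF ij(2)] algebra_simps del: index_mult_mat(1))
      also have "\<dots> = B z $$ (i,j)"
      \<comment> \<open>For a negative sum \<open>B\<close> and \<open>B0\<close> both vanish here;
        for sum 0 the weights vanish and \<open>h\<close> holds the constant entry; for a positive
        sum \<open>B0\<close> vanishes and the weights add up to 1.\<close>
      proof (cases "k i + k j" "0::int" rule: linorder_cases)
        case less
        thus ?thesis using ij H_entry(1)[OF ij less] by (simp add: B B0 h_def w_def)
      next
        case equal
        thus ?thesis using ij H_entry(2)[OF ij equal, of "1 / z"] by (simp add: B B0 h_def w_def)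
      next
        case greater
        hence "w i j + w j i = 1" by (auto simp: w_def)
        thus ?thesis using ij greater by (simp add: B0 h_def)
      qed
      finally show "B z $$ (i,j) = (U z * B0 z * transpose_mat (U (1 / z))) $$ (i,j)" by simp
    qed auto
    thus "dpow d k z * H (1 / z) = U z * (dpow d k z * h) * transpose_mat (U (1 / z))"
      by (simp add: B_def B0_def)
  qed
qed

end

section \<open>The normal form\<close>

text \<open>Each sum has at most one nonzero summand at a given entry, with \<open>m\<close> fixed
  by the column in one kind of matrix unit and by the row in the other. With indices from 0 both
  kinds lie on \<open>i + j = d - 1\<close>.\<close>

lemma D3_entry:
  assumes "i < d" "j < d"
  shows "D3 d \<kappa> z $$ (i,j) = (if i + j = d - 1 then
      - ((if 0 < \<kappa> (Suc j) then z powi \<kappa> (Suc j) else 0) - (if 0 < \<kappa> (Suc i) then z powi (- \<kappa> (Suc i)) else 0))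
      + ((if \<kappa> (Suc j) = 0 \<and> 2 * Suc j \<le> d then 1 else 0) - (if \<kappa> (Suc i) = 0 \<and> 2 * Suc i \<le> d then 1 else 0))
    else 0)"
proof -
  have col: "(\<Sum>m\<in>S. f m * munit d (d + 1 - m) m $$ (i,j)) = (if Suc j \<in> S \<and> i + j = d - 1 then f (Suc j) else 0)"
    and row: "(\<Sum>m\<in>S. f m * munit d m (d + 1 - m) $$ (i,j)) = (if Suc i \<in> S \<and> i + j = d - 1 then f (Suc i) else 0)"
    if "S \<subseteq> {1..d}" for S and f :: "nat \<Rightarrow> complex"
  proof -
    have fin: "finite S" using that by (rule finite_subset) simp
    have "(\<Sum>m\<in>S. f m * munit d (d + 1 - m) m $$ (i,j)) = (\<Sum>m\<in>S. if m = Suc j then if i + j = d - 1 then f m else 0 else 0)"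
      using assms that by (intro sum.cong) (auto simp: munit_def)
    thus "(\<Sum>m\<in>S. f m * munit d (d + 1 - m) m $$ (i,j)) = (if Suc j \<in> S \<and> i + j = d - 1 then f (Suc j) else 0)"
      using fin by simp
    have "(\<Sum>m\<in>S. f m * munit d m (d + 1 - m) $$ (i,j)) = (\<Sum>m\<in>S. if m = Suc i then if i + j = d - 1 then f m else 0 else 0)"
      using assms that by (intro sum.cong) (auto simp: munit_def)
    thus "(\<Sum>m\<in>S. f m * munit d m (d + 1 - m) $$ (i,j)) = (if Suc i \<in> S \<and> i + j = d - 1 then f (Suc i) else 0)"
      using fin by simp
  qed
  define S where "S = {m. 1 \<le> m \<and> m \<le> d \<and> 0 < \<kappa> m}"
  define T where "T = {m. 1 \<le> m \<and> m \<le> d \<and> \<kappa> m = 0 \<and> 2 * m \<le> d}"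
  have ST: "S \<subseteq> {1..d}" "T \<subseteq> {1..d}" by (auto simp: S_def T_def)
  have "D3 d \<kappa> z $$ (i,j) =
     - ((\<Sum>m\<in>S. z powi \<kappa> m * munit d (d + 1 - m) m $$ (i,j)) - (\<Sum>m\<in>S. z powi (- \<kappa> m) * munit d m (d + 1 - m) $$ (i,j)))
     + ((\<Sum>m\<in>T. 1 * munit d (d + 1 - m) m $$ (i,j)) - (\<Sum>m\<in>T. 1 * munit d m (d + 1 - m) $$ (i,j)))"
    using assms by (simp add: D3_def S_def T_def sum_subtractf)
  also have "\<dots> = - ((if Suc j \<in> S \<and> i + j = d - 1 then z powi \<kappa> (Suc j) else 0)
        - (if Suc i \<in> S \<and> i + j = d - 1 then z powi (- \<kappa> (Suc i)) else 0))
     + ((if Suc j \<in> T \<and> i + j = d - 1 then 1 else 0) - (if Suc i \<in> T \<and> i + j = d - 1 then 1 else 0))"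
    unfolding col[OF ST(1)] row[OF ST(1)] col[OF ST(2)] row[OF ST(2)] by (rule refl)
  finally show ?thesis using assms by (simp add: S_def T_def)
qed

context coefficient_field
begin

text \<open>\<open>S\<close> is a scaled reversal of the order, because
  \<open>dpow d k z * g\<close> carries the exponent \<open>k i\<close> at \<open>(i, bar i)\<close>
  whereas \<open>D3\<close> carries it at \<open>(bar i, i)\<close>.\<close>

lemma antidiagonal_eq_D3:
  assumes g: "graded_skew d k g"
    and anti: "\<And>i j. i < d \<Longrightarrow> j < d \<Longrightarrow> i + j \<noteq> d - 1 \<Longrightarrow> g $$ (i,j) = 0"
    and k: "\<And>i. i < d \<Longrightarrow> k (d - 1 - i) = - k i" "\<And>i. i < d \<Longrightarrow> k i = \<kappa> (Suc i)"
  obtains S where "S \<in> carrier_mat d d" "\<And>i j. i < d \<Longrightarrow> j < d \<Longrightarrow> S $$ (i,j) \<in> F" "det S \<noteq> 0"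
    "\<And>z. z \<noteq> 0 \<Longrightarrow> dpow d k z * g = S * D3 d \<kappa> z * transpose_mat S"
proof -
  have [simp]: "g \<in> carrier_mat d d" using g by (rule graded_skew_carrier)
  hence [simp]: "dim_row g = d" "dim_col g = d" by (auto simp del: \<open>g \<in> _\<close>)
  have [simp]: "D3 d \<kappa> z \<in> carrier_mat d d" for z by (simp add: D3_def)
  hence [simp]: "dim_row (D3 d \<kappa> z) = d" "dim_col (D3 d \<kappa> z) = d" for z by (auto simp: D3_def)
  define bar where "bar i = d - 1 - i" for i
  have bar: "bar i < d" "bar (bar i) = i" "i + bar i = d - 1" if "i < d" for i
    using that by (auto simp: bar_def)
  \<comment> \<open>A middle row could be nonzero only on the diagonal, where skewness forces 0;
    nondegeneracy thus excludes a middle index.\<close>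
  have bar_ne: "bar i \<noteq> i" if i: "i < d" for i
  proof
    assume "bar i = i"
    obtain j where j: "j < d" "g $$ (i,j) \<noteq> 0"
      using det_nonzero_row[OF graded_skew_carrier[OF g] graded_skew_det[OF g] i] .
    hence "i + j = d - 1" using anti[OF i] by blast
    hence "j = i" using \<open>bar i = i\<close> i by (simp add: bar_def)
    thus False using j graded_skew_diag[OF g i] by simp
  qed
  \<comment> \<open>The sign of \<open>D3\<close> at \<open>(bar i, i)\<close>; for index 0 it is
    negative in the second half of the positions.\<close>
  define \<epsilon> :: "nat \<Rightarrow> complex" where
    "\<epsilon> i = (if 0 < k i \<or> (k i = 0 \<and> d < 2 * Suc i) then -1 else 1)" for i
  have \<epsilon>2: "\<epsilon> i * \<epsilon> i = 1" for i by (simp add: \<epsilon>_def)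
  have \<epsilon>_bar: "\<epsilon> (bar i) = - \<epsilon> i" if "i < d" for i
    using that k(1)[OF that] bar_ne[OF that] by (auto simp: \<epsilon>_def bar_def)
  have D3: "D3 d \<kappa> z $$ (bar i, i) = \<epsilon> i * z powi k i" if i: "i < d" for z i
  proof -
    have kk: "\<kappa> (Suc i) = k i" "\<kappa> (Suc (bar i)) = - k i"
      using k(2)[OF i] k(2)[OF bar(1)[OF i]] k(1)[OF i] by (simp_all add: bar_def)
    have "(2 * Suc (bar i) \<le> d) = (d < 2 * Suc i)"
      using i bar_ne[OF i] by (auto simp: bar_def)
    thus ?thesis
      using D3_entry[OF bar(1)[OF i] i, of \<kappa> z] bar(3)[OF i]
      unfolding kk by (auto simp: \<epsilon>_def add.commute)
  qed
  have D3_0: "D3 d \<kappa> z $$ (i,j) = 0" if "i < d" "j < d" "i + j \<noteq> d - 1" for z i j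
    using that by (simp add: D3_entry)
  \<comment> \<open>The whole factor goes to the first member of each pair; no square root is taken,
    so the entries stay in \<open>F\<close>.\<close>
  define t where "t i = (if 2 * Suc i \<le> d then \<epsilon> i * g $$ (i, bar i) else 1)" for i
  have t: "t i * t (bar i) * \<epsilon> i = g $$ (i, bar i)" if i: "i < d" for i
  proof (cases "2 * Suc i \<le> d")
    case True
    hence "t (bar i) = 1" using i by (auto simp: t_def bar_def)
    thus ?thesis using True \<epsilon>2[of i] by (simp add: t_def mult_ac)
  next
    case False
    hence "2 * Suc (bar i) \<le> d" using i bar_ne[OF i] by (auto simp: bar_def)
    hence "t i * t (bar i) * \<epsilon> i = \<epsilon> (bar i) * g $$ (bar i, i) * \<epsilon> i"
      using False bar(2)[OF i] by (simp add: t_def)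
    also have "\<dots> = (\<epsilon> i * \<epsilon> i) * g $$ (i, bar i)"
      using graded_skew_entry(2)[OF g i bar(1)[OF i]] by (simp add: \<epsilon>_bar[OF i])
    finally show ?thesis by (simp add: \<epsilon>2)
  qed
  define S where "S = mat d d (\<lambda>(i,j). if j = bar i then t i else 0)"
  have [simp]: "S \<in> carrier_mat d d" "dim_row S = d" "dim_col S = d" by (simp_all add: S_def)
  have eq: "dpow d k z * g = S * D3 d \<kappa> z * transpose_mat S" for z
  proof (rule eq_matI)
    fix i j assume "i < dim_row (S * D3 d \<kappa> z * transpose_mat S)" "j < dim_col (S * D3 d \<kappa> z * transpose_mat S)"
    hence ij: "i < d" "j < d" by auto
    have S: "(\<Sum>l = 0..<d. S $$ (a,l) * f l) = t a * f (bar a)" if "a < d" for a f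
    proof -
      have "(\<Sum>l = 0..<d. S $$ (a,l) * f l) = (\<Sum>l = 0..<d. if l = bar a then t a * f l else 0)"
        using that by (intro sum.cong) (auto simp: S_def)
      thus ?thesis using bar(1)[OF that] by simp
    qed
    have SD: "(S * D3 d \<kappa> z) $$ (i,l) = t i * D3 d \<kappa> z $$ (bar i, l)" if "l < d" for l
      using that ij S[OF ij(1)] by (simp add: scalar_prod_def)
    have "(S * D3 d \<kappa> z * transpose_mat S) $$ (i,j) = (\<Sum>l = 0..<d. S $$ (j,l) * (S * D3 d \<kappa> z) $$ (i,l))"
      using ij by (subst index_mult_mat) (simp_all add: scalar_prod_def mult.commute del: index_mult_mat(1))
    also have "\<dots> = t j * (t i * D3 d \<kappa> z $$ (bar i, bar j))"
      using S[OF ij(2)] SD[OF bar(1)[OF ij(2)]] by simp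
    also have "\<dots> = z powi k i * g $$ (i,j)"
    proof (cases "j = bar i")
      case True
      thus ?thesis using D3[OF ij(1), of z] t[OF ij(1)] bar(2)[OF ij(1)] by (simp add: mult_ac)
    next
      case False
      hence "i + j \<noteq> d - 1" "bar i + bar j \<noteq> d - 1" using ij by (auto simp: bar_def)
      thus ?thesis using anti[OF ij] D3_0[OF bar(1)[OF ij(1)] bar(1)[OF ij(2)]] by simp
    qed
    also have "\<dots> = (dpow d k z * g) $$ (i,j)" using ij by (simp add: dpow_mult_entry[where d = d] del: index_mult_mat(1))
    finally show "(dpow d k z * g) $$ (i,j) = (S * D3 d \<kappa> z * transpose_mat S) $$ (i,j)" by simp
  qed auto
  show ?thesis
  proof (rule that[OF _ _ _ eq])
    fix i j assume ij: "i < d" "j < d"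
    have "\<epsilon> i \<in> F" using closed by (simp add: \<epsilon>_def)
    hence "t i \<in> F"
      using graded_skew_entry(1)[OF g ij(1) bar(1)[OF ij(1)]] closed(2,4) by (simp add: t_def)
    thus "S $$ (i,j) \<in> F" using ij closed(1) by (simp add: S_def)
  next
    \<comment> \<open>At \<open>z = 1\<close> the identity just proved factors \<open>det g\<close>
      through \<open>det S\<close>.\<close>
    have "dpow d k 1 = 1\<^sub>m d" by (rule eq_matI) (auto simp: dpow_def)
    hence "g = S * D3 d \<kappa> 1 * transpose_mat S" using eq[of 1] by (simp add: left_mult_one_mat[of _ d d])
    hence "det g = det S * det (D3 d \<kappa> 1) * det S"
      by (simp add: det_mult[of _ d] mult_carrier_mat[of _ d d _ d] det_transpose[of _ d])
    thus "det S \<noteq> 0" using graded_skew_det[OF g] by auto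
  qed simp
qed

end

section \<open>Assembly of the factorization\<close>

theorem theorem3p3:
  fixes d :: nat and F :: "complex set" and A :: "complex \<Rightarrow> complex mat" and \<kappa> :: "nat \<Rightarrow> int"
  assumes "F = \<real> \<or> F = UNIV"
    and "is_laurent_mat d F A"
    and "\<forall>z. z \<noteq> 0 \<longrightarrow> lt_transpose A z = - A z"
    and "\<forall>z. cmod z = 1 \<longrightarrow> det (A z) \<noteq> 0"
    and "has_partial_indices d F A \<kappa>"
  shows "\<exists>Ap. is_poly_mat d F Ap \<and> (\<forall>z. cmod z \<le> 1 \<longrightarrow> det (Ap z) \<noteq> 0) \<and>
           (\<forall>z. z \<noteq> 0 \<longrightarrow> A z = Ap z * D3 d \<kappa> z * lt_transpose Ap z)"
proof -
  interpret coefficient_field F by unfold_locales (rule assms(1))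
  define k where "k i = \<kappa> (Suc i)" for i
  have D: "diag_pow d \<kappa> = dpow d k" by (auto simp: diag_pow_def dpow_def k_def fun_eq_iff)
  obtain P Q where P: "P \<in> poly_mats d" "\<And>z. cmod z \<le> 1 \<Longrightarrow> det (P z) \<noteq> 0"
    and Q: "Q \<in> poly_mats d" "\<And>z. cmod z \<le> 1 \<Longrightarrow> det (Q z) \<noteq> 0"
    and A: "\<And>z. z \<noteq> 0 \<Longrightarrow> A z = P z * dpow d k z * Q (1 / z)"
    and mono: "\<And>m m'. 1 \<le> m \<Longrightarrow> m \<le> m' \<Longrightarrow> m' \<le> d \<Longrightarrow> \<kappa> m' \<le> \<kappa> m"
    using assms(5) unfolding has_partial_indices_def D is_poly_mat_iff by blast
  have [simp]: "P z \<in> carrier_mat d d" "Q z \<in> carrier_mat d d" for z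
    using P(1) Q(1) by (auto intro: poly_mats_carrier)
  have skew: "transpose_mat (P (1 / z) * dpow d k (1 / z) * Q z) = - (P z * dpow d k z * Q (1 / z))"
    if z: "z \<noteq> 0" for z
  proof -
    have "transpose_mat (A (1 / z)) = - A z" using assms(3) z by (simp add: lt_transpose_def)
    moreover have "A (1 / z) = P (1 / z) * dpow d k (1 / z) * Q z" using A[of "1 / z"] z by simp
    ultimately show ?thesis using A[OF z] by simp
  qed
  obtain H where H: "H \<in> poly_mats d" and HP: "\<And>z. H z * transpose_mat (P z) = Q z"
    and reflection: "\<And>z i j. z \<noteq> 0 \<Longrightarrow> i < d \<Longrightarrow> j < d \<Longrightarrow> H z $$ (j,i) = - (z powi (k i + k j)) * H (1 / z) $$ (i,j)"
    by (rule skew_factorization[OF P Q(1) skew]; blast)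
  have [simp]: "H z \<in> carrier_mat d d" for z using H by (rule poly_mats_carrier)
  have "det (Q z) = det (H z) * det (P z)" for z
    unfolding HP[of z, symmetric] by (simp add: det_mult[of _ d] det_transpose[of _ d])
  hence det_H: "det (H z) \<noteq> 0" if "cmod z \<le> 1" for z using Q(2)[OF that] by auto
  interpret skew_kernel F d k H
  proof unfold_locales
    show "k j \<le> k i" if "i \<le> j" "j < d" for i j
      using mono[of "Suc i" "Suc j"] that by (simp add: k_def)
  qed (fact H reflection det_H)+
  obtain U where U: "U \<in> poly_mats d" "\<And>z. det (U z) = 1"
    "\<And>z. z \<noteq> 0 \<Longrightarrow> dpow d k z * H (1 / z) = U z * (dpow d k z * h) * transpose_mat (U (1 / z))"
    by (rule reduce_to_constant) blast
  obtain g where g: "graded_skew d k g" "graded_congruent d k h g"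
    "\<And>i j. i < d \<Longrightarrow> j < d \<Longrightarrow> i + j \<noteq> d - 1 \<Longrightarrow> g $$ (i,j) = 0"
    by (rule antidiagonal_form[OF graded_skew_h symmetric]; blast)
  obtain L where L: "graded d k L" "h = L * g * transpose_mat L"
    using g(2) unfolding graded_congruent_def by blast
  obtain S where S: "S \<in> carrier_mat d d" "\<And>i j. i < d \<Longrightarrow> j < d \<Longrightarrow> S $$ (i,j) \<in> F" "det S \<noteq> 0"
    "\<And>z. z \<noteq> 0 \<Longrightarrow> dpow d k z * g = S * D3 d \<kappa> z * transpose_mat S"
    by (rule antidiagonal_eq_D3[OF g(1,3) symmetric k_def]; blast)
  have [simp]: "U z \<in> carrier_mat d d" "L \<in> carrier_mat d d" "S \<in> carrier_mat d d" "g \<in> carrier_mat d d"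
    "D3 d \<kappa> z \<in> carrier_mat d d" for z
    using poly_mats_carrier[OF U(1)] L(1) S(1) graded_skew_carrier[OF g(1)] by (auto simp: graded_def D3_def)
  note square = mult_carrier_mat[of _ d d _ d]
  have "det h = det L * det g * det L"
    unfolding L(2) by (simp add: square det_mult[of _ d] det_transpose[of _ d])
  hence detL: "det L \<noteq> 0" using graded_skew_det[OF graded_skew_h] by auto
  have dimL: "dim_row L = d" "dim_col L = d" by (rule carrier_matD[of L d d], simp)+
  \<comment> \<open>The grading of \<open>L\<close> is used here: it carries the congruence of
    \<open>h\<close> over to \<open>D h\<close>.\<close>
  have DL: "dpow d k z * L = L * dpow d k z" for z
  proof (rule eq_matI)
    fix i j assume "i < dim_row (L * dpow d k z)" "j < dim_col (L * dpow d k z)"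
    hence ij: "i < d" "j < d" by (simp_all add: dimL)
    hence "L $$ (i,j) = 0 \<or> k i = k j" using L(1) unfolding graded_def by blast
    thus "(dpow d k z * L) $$ (i,j) = (L * dpow d k z) $$ (i,j)"
      using ij by (auto simp: dpow_mult_entry[where d = d] simp del: index_mult_mat(1))
  qed (simp_all add: dimL)
  \<comment> \<open>The left factors of the successive congruences; \<open>L\<close> and
    \<open>S\<close> are constant, so replacing \<open>z\<close> by \<open>1 / z\<close> does not
    affect them.\<close>
  define Ap where "Ap z = P z * (U z * (L * S))" for z
  have "Ap \<in> poly_mats d"
    unfolding Ap_def using L(1) S(2)
    by (intro poly_mats_mult P(1) U(1) poly_mats_const) (auto simp: graded_def)
  moreover have "det (Ap z) \<noteq> 0" if "cmod z \<le> 1" for z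
    unfolding Ap_def using P(2)[OF that] U(2)[of z] detL S(3) by (simp add: square det_mult[of _ d])
  moreover have "A z = Ap z * D3 d \<kappa> z * lt_transpose Ap z" if z: "z \<noteq> 0" for z
  proof -
    have "dpow d k z * h = dpow d k z * L * g * transpose_mat L"
      unfolding L(2) by (simp add: square assoc_mult_mat[of _ d d _ d _ d])
    also have "\<dots> = L * (dpow d k z * g) * transpose_mat L"
      unfolding DL by (simp add: square assoc_mult_mat[of _ d d _ d _ d])
    finally have Dh: "dpow d k z * h = L * (dpow d k z * g) * transpose_mat L" .
    \<comment> \<open>Replacing \<open>Q (1 / z)\<close> through \<open>HP\<close> exhibits
      \<open>A\<close> as a congruence of the skew kernel by \<open>P\<close>.\<close>
    have "A z = P z * (dpow d k z * H (1 / z)) * transpose_mat (P (1 / z))"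
      unfolding A[OF z] HP[of "1 / z", symmetric] by (simp add: square assoc_mult_mat[of _ d d _ d _ d])
    also have "dpow d k z * H (1 / z) = U z * (L * (S * D3 d \<kappa> z * transpose_mat S) * transpose_mat L) * transpose_mat (U (1 / z))"
      unfolding U(3)[OF z] Dh S(4)[OF z] by (rule refl)
    also have "P z * (U z * (L * (S * D3 d \<kappa> z * transpose_mat S) * transpose_mat L) * transpose_mat (U (1 / z)))
        * transpose_mat (P (1 / z)) = Ap z * D3 d \<kappa> z * transpose_mat (Ap (1 / z))"
      unfolding Ap_def by (simp add: square congruence_trans[where d = d])
    finally show ?thesis by (simp add: lt_transpose_def)
  qed
  ultimately show ?thesis unfolding is_poly_mat_iff by blast
qed

end
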